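(* Let $\overline{h}$ be a Hopf monoid in vector species with a character $\eta:\overline{h}\Rightarrow\overline{E}$. Then there is a unique combinatorial Hopf monoid morphism $\boldsymbol{\Upsilon}_{\overline{h}}:(\overline{h},\eta)\Rightarrow(\overline{\mathbf{WQSym}},\eta_0)$, i.e. a unique Hopf monoid morphism $\boldsymbol{\Upsilon}_{\overline{h}}:\overline{h}\Rightarrow\overline{\mathbf{WQSym}}$ such that $\eta_0\circ\boldsymbol{\Upsilon}_{\overline{h}}=\eta$.
   Context: $\mathbb{K}$ is a field of characteristic zero. A (vector) species is a functor from the category of finite sets with bijections to the category of $\mathbb{K}$-vector spaces. The Cauchy product of species is $(\overline{a}\cdot\overline{b})[I]=\bigoplus_{I=S\sqcup T}\overline{a}[S]\otimes\overline{b}[T]$, with unit species $\overline{I}$ ($\overline{I}[\emptyset]=\mathbb{K}$, $\overline{I}[A]=0$ for $A\ne\emptyset$). A bimonoid (resp. Hopf monoid) in species is a bimonoid (resp. Hopf monoid, i.e. a bimonoid with an antipode) in this symmetric monoidal category (symmetry given by the usual swap of tensor factors). Its structure is given by natural maps $\mu_{A,B}:\overline{h}[A]\otimes\overline{h}[B]\to\overline{h}[A\sqcup B]$, $\Delta_{A,B}:\overline{h}[A\sqcup B]\to\overline{h}[A]\otimes\overline{h}[B]$, a unit $\iota_\emptyset:\mathbb{K}\to\overline{h}[\emptyset]$ and a counit $\epsilon_\emptyset:\overline{h}[\emptyset]\to\mathbb{K}$ ($\epsilon$ is zero on $\overline{h}[I]$ for $I\neq\emptyset$). Hopf monoid morphisms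 are natural transformations compatible with $\mu,\iota,\Delta,\epsilon$. No connectedness ($\dim\overline{h}[\emptyset]=1$) is assumed. $\overline{E}$ is the exponential species: $\overline{E}[A]=\mathbb{K}$ for all $A$, bijections acting as the identity, with product the canonical isomorphism $\mathbb{K}\otimes\mathbb{K}\cong\mathbb{K}$. A character of $\overline{h}$ is a monoid morphism $\eta:\overline{h}\Rightarrow\overline{E}$ (so $\eta_{I\sqcup J}(\mu_{I,J}(a\otimes b))=\eta_I(a)\eta_J(b)$ and $\eta$ preserves the unit) such that $\eta_\emptyset=\epsilon_\emptyset$. A combinatorial Hopf monoid is a pair $(\overline{h},\eta)$ of a Hopf monoid and a character; a combinatorial Hopf monoid morphism $(\overline{h}_1,\eta_1)\Rightarrow(\overline{h}_2,\eta_2)$ is a Hopf monoid morphism $\alpha$ with $\eta_2\circ\alpha=\eta_1$. $\overline{\mathbf{WQSym}}$: $\overline{\mathbf{WQSym}}[I]$ is the vector space with basis $\{\mathbb{M}_{\vec{\boldsymbol{\pi}}}\}$ indexed by set compositions $\vec{\boldsymbol{\pi}}=S_1|\cdots|S_l$ of $I$ (ordered lists of non-empty disjoint sets with union $I$; $l=l(\vec{\boldsymbol{\pi}})$ is the length; $\emptyset$ has exactly one set composition, of length $0$). Bijections act by relabelling. For $A\subseteq I$, $\vec{\boldsymbol{\pi}}|_A$ is the set composition of $A$ obtained by intersecting each block with $A$ and deleting empty blocks. The product is $\mathbb{M}_{\vec{\boldsymbol{\pi}}}\cdot_{A,B}\mathbb{M}_{\vec{\boldsymbol{\tau}}}=\sum_{\vec{\boldsymbol{\gamma}}}\mathbb{M}_{\vec{\boldsymbol{\gamma}}}$,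 over set compositions $\vec{\boldsymbol{\gamma}}$ of $A\sqcup B$ with $\vec{\boldsymbol{\gamma}}|_A=\vec{\boldsymbol{\pi}}$ and $\vec{\boldsymbol{\gamma}}|_B=\vec{\boldsymbol{\tau}}$. The coproduct is $\Delta_{I,J}\mathbb{M}_{\vec{\boldsymbol{\pi}}}=\mathbb{M}_{\vec{\boldsymbol{\pi}}|_I}\otimes\mathbb{M}_{\vec{\boldsymbol{\pi}}|_J}$ if every $i\in I$ lies in a strictly earlier block of $\vec{\boldsymbol{\pi}}$ than every $j\in J$, and $0$ otherwise. The unit is $\iota_\emptyset(1)=\mathbb{M}_\emptyset$, the counit is $\epsilon(\mathbb{M}_{\vec{\boldsymbol{\pi}}})=1$ if $\vec{\boldsymbol{\pi}}=\emptyset$ and $0$ otherwise. This is a Hopf monoid, and $\eta_0[I](\mathbb{M}_{\vec{\boldsymbol{\pi}}})=1$ if $l(\vec{\boldsymbol{\pi}})\le1$ and $0$ otherwise defines a character $\eta_0$ on it. *)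

theory Defs
  imports Complex_Main "HOL-Library.FuncSet" "HOL-Library.Function_Algebras"
    "HOL-Library.Infinite_Typeclass"
begin

section \<open>Vector spaces and tensor products\<close>

text \<open>A vector space over the field \<^typ>\<open>'k\<close> is a subspace of an ambient vector space on the type
  \<^typ>\<open>'v\<close>.  A family of vector spaces that share the ambient type is not a restriction: any family
  embeds into its direct sum.\<close>

record ('k, 'v) vec =
  scl :: "'k \<Rightarrow> 'v \<Rightarrow> 'v"
  car :: "'v set"

definition is_vec :: "('k::field, 'v::ab_group_add) vec \<Rightarrow> bool" where
  "is_vec V \<longleftrightarrow> vector_space (scl V) \<and> module.subspace (scl V) (car V)"

definition linear_map ::
    "('k, 'v::ab_group_add) vec \<Rightarrow> ('k, 'w::ab_group_add) vec \<Rightarrow> ('v \<Rightarrow> 'w) \<Rightarrow> bool" where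
  "linear_map V W f \<longleftrightarrow> f \<in> car V \<rightarrow> car W \<and>
     (\<forall>x\<in>car V. \<forall>y\<in>car V. f (x + y) = f x + f y) \<and>
     (\<forall>c. \<forall>x\<in>car V. f (scl V c x) = scl W c (f x))"

definition bilinear_map ::
    "('k, 'v::ab_group_add) vec \<Rightarrow> ('k, 'w::ab_group_add) vec \<Rightarrow> ('k, 'u::ab_group_add) vec
      \<Rightarrow> ('v \<Rightarrow> 'w \<Rightarrow> 'u) \<Rightarrow> bool" where
  "bilinear_map V W U f \<longleftrightarrow>
     (\<forall>y\<in>car W. linear_map V U (\<lambda>x. f x y)) \<and> (\<forall>x\<in>car V. linear_map W U (f x))"

definition ground :: "('k::field, 'k) vec" where
  "ground = \<lparr>scl = (*), car = UNIV\<rparr>"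

definition fscale :: "'k::times \<Rightarrow> ('x \<Rightarrow> 'k) \<Rightarrow> 'x \<Rightarrow> 'k" where
  "fscale c f = (\<lambda>x. c * f x)"

text \<open>The pure tensor of \<open>x\<close> and \<open>y\<close> is evaluation at \<open>(x, y)\<close>, as a functional on the bilinear forms
  of the ambient spaces; \<open>V \<otimes> W\<close> is spanned by the pure tensors with \<open>x \<in> V\<close> and \<open>y \<in> W\<close>.
  Over a field this is a model of the tensor product: the universal property is proved below.\<close>

type_synonym ('v, 'w, 'k) tensor = "('v \<Rightarrow> 'w \<Rightarrow> 'k) \<Rightarrow> 'k"

definition bilinear_form ::
    "('k::field \<Rightarrow> 'v::ab_group_add \<Rightarrow> 'v) \<Rightarrow> ('k \<Rightarrow> 'w::ab_group_add \<Rightarrow> 'w)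
      \<Rightarrow> ('v \<Rightarrow> 'w \<Rightarrow> 'k) \<Rightarrow> bool" where
  "bilinear_form s t B \<longleftrightarrow>
     (\<forall>y. Vector_Spaces.linear s (*) (\<lambda>x. B x y)) \<and> (\<forall>x. Vector_Spaces.linear t (*) (B x))"

definition pure ::
    "('k::field, 'v::ab_group_add) vec \<Rightarrow> ('k, 'w::ab_group_add) vec \<Rightarrow> 'v \<Rightarrow> 'w
      \<Rightarrow> ('v, 'w, 'k) tensor" where
  "pure V W x y = (\<lambda>B. if bilinear_form (scl V) (scl W) B then B x y else 0)"

definition tensor ::
    "('k::field, 'v::ab_group_add) vec \<Rightarrow> ('k, 'w::ab_group_add) vec
      \<Rightarrow> ('k, ('v, 'w, 'k) tensor) vec"  (infixl \<open>\<otimes>\<close> 70) where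
  "V \<otimes> W = \<lparr>scl = fscale,
     car = module.span fscale {pure V W x y | x y. x \<in> car V \<and> y \<in> car W}\<rparr>"

text \<open>The linear map out of \<open>V \<otimes> W\<close> induced by a bilinear map; its values are only specified on
  \<open>car (V \<otimes> W)\<close>.\<close>

definition tensor_lift ::
    "('k::field, 'v::ab_group_add) vec \<Rightarrow> ('k, 'w::ab_group_add) vec \<Rightarrow> ('k, 'u::ab_group_add) vec
      \<Rightarrow> ('v \<Rightarrow> 'w \<Rightarrow> 'u) \<Rightarrow> ('v, 'w, 'k) tensor \<Rightarrow> 'u" where
  "tensor_lift V W U f = (SOME g. linear_map (V \<otimes> W) U g \<and>
     (\<forall>x\<in>car V. \<forall>y\<in>car W. g (pure V W x y) = f x y))"

lemma vector_space_fscale: "vector_space (fscale :: 'k::field \<Rightarrow> ('x \<Rightarrow> 'k) \<Rightarrow> _)"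
  by unfold_locales (auto simp: fscale_def fun_eq_iff algebra_simps)

lemma vector_space_times: "vector_space ((*) :: 'k::field \<Rightarrow> 'k \<Rightarrow> 'k)"
  by unfold_locales (auto simp: algebra_simps)

lemma is_vec_tensor:
  fixes V :: "('k::field, 'v::ab_group_add) vec" and W :: "('k, 'w::ab_group_add) vec"
  shows "is_vec (V \<otimes> W)"
proof -
  interpret F: vector_space "fscale :: 'k \<Rightarrow> (('v, 'w, 'k) tensor) \<Rightarrow> _"
    by (rule vector_space_fscale)
  show ?thesis
    unfolding is_vec_def tensor_def by (simp add: F.subspace_span F.vector_space_axioms)
qed

lemma pure_in_tensor:
  fixes V :: "('k::field, 'v::ab_group_add) vec" and W :: "('k, 'w::ab_group_add) vec"
  shows "x \<in> car V \<Longrightarrow> y \<in> car W \<Longrightarrow> pure V W x y \<in> car (V \<otimes> W)"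
proof -
  interpret F: vector_space "fscale :: 'k \<Rightarrow> (('v, 'w, 'k) tensor) \<Rightarrow> _"
    by (rule vector_space_fscale)
  assume "x \<in> car V" "y \<in> car W"
  then show ?thesis
    unfolding tensor_def by (auto intro: F.span_base)
qed

lemma tensor_map_unique:
  fixes V :: "('k::field, 'v::ab_group_add) vec" and W :: "('k, 'w::ab_group_add) vec"
    and U :: "('k, 'u::ab_group_add) vec"
  assumes U: "is_vec U" and f: "linear_map (V \<otimes> W) U f" and g: "linear_map (V \<otimes> W) U g"
    and eq: "\<And>x y. x \<in> car V \<Longrightarrow> y \<in> car W \<Longrightarrow> f (pure V W x y) = g (pure V W x y)"
    and t: "t \<in> car (V \<otimes> W)"
  shows "f t = g t"
proof -
  interpret F: vector_space "fscale :: 'k \<Rightarrow> (('v, 'w, 'k) tensor) \<Rightarrow> _"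
    by (rule vector_space_fscale)
  interpret U: vector_space "scl U" using U by (simp add: is_vec_def)
  let ?P = "{pure V W x y | x y. x \<in> car V \<and> y \<in> car W}"
  have car: "car (V \<otimes> W) = F.span ?P" and scl: "scl (V \<otimes> W) = fscale"
    by (simp_all add: tensor_def)
  have zero: "h 0 = 0" if "linear_map (V \<otimes> W) U h" for h
  proof -
    have "h (fscale 0 0) = scl U 0 (h 0)"
      using that F.span_zero unfolding linear_map_def car scl by blast
    then show ?thesis by simp
  qed
  have "t \<in> F.span ?P \<and> f t = g t"
    using t[unfolded car]
  proof (induction t rule: F.span_induct_alt)
    case base
    show ?case by (intro conjI F.span_zero) (simp only: zero[OF f] zero[OF g])
  next
    case (step c p t)
    then obtain x y where p: "p = pure V W x y" "x \<in> car V" "y \<in> car W" by auto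
    have pin: "p \<in> F.span ?P" using step by (auto intro: F.span_base)
    have cp: "fscale c p \<in> F.span ?P" using pin by (rule F.span_scale)
    have "h (fscale c p + t) = scl U c (h p) + h t" if "linear_map (V \<otimes> W) U h" for h
      using that cp pin step unfolding linear_map_def car scl by auto
    from this[OF f] this[OF g] have "f (fscale c p + t) = g (fscale c p + t)"
      using step eq[OF p(2,3)] p(1) by simp
    moreover have "fscale c p + t \<in> F.span ?P" using cp step by (blast intro: F.span_add)
    ultimately show ?case by blast
  qed
  then show ?thesis ..
qed

lemma tensor_lift_universal:
  fixes V :: "('k::field, 'v::ab_group_add) vec" and W :: "('k, 'w::ab_group_add) vec"
    and U :: "('k, 'u::ab_group_add) vec"
  assumes V: "is_vec V" and W: "is_vec W" and U: "is_vec U" and f: "bilinear_map V W U f"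
  shows "linear_map (V \<otimes> W) U (tensor_lift V W U f)"
    and "x \<in> car V \<Longrightarrow> y \<in> car W \<Longrightarrow> tensor_lift V W U f (pure V W x y) = f x y"
proof -
  interpret F: vector_space "fscale :: 'k \<Rightarrow> (('v, 'w, 'k) tensor) \<Rightarrow> _"
    by (rule vector_space_fscale)
  interpret K: vector_space "(*) :: 'k \<Rightarrow> 'k \<Rightarrow> 'k" by (rule vector_space_times)
  interpret V: vector_space "scl V" using V by (simp add: is_vec_def)
  interpret W: vector_space "scl W" using W by (simp add: is_vec_def)
  interpret U: vector_space "scl U" using U by (simp add: is_vec_def)
  interpret VV: vector_space_pair "scl V" "scl V" ..
  interpret WW: vector_space_pair "scl W" "scl W" ..
  interpret UK: vector_space_pair "scl U" "(*)" ..
  interpret FU: vector_space_pair "fscale :: 'k \<Rightarrow> (('v, 'w, 'k) tensor) \<Rightarrow> _" "scl U" ..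
  have sV: "V.subspace (car V)" and sW: "W.subspace (car W)" and sU: "U.subspace (car U)"
    using V W U by (simp_all add: is_vec_def)
  have "\<exists>p. Vector_Spaces.linear (scl V) (scl V) p \<and> (\<forall>x\<in>car V. p x = x) \<and> range p = car V"
  proof -
    obtain B where B: "B \<subseteq> car V" "V.independent B" "car V \<subseteq> V.span B"
      using V.maximal_independent_subset .
    then have sp: "V.span B = car V" using sV V.span_subspace by blast
    obtain p where p: "Vector_Spaces.linear (scl V) (scl V) p" "\<forall>x\<in>B. p x = x"
        "range p = V.span (id ` B)"
      using VV.linear_independent_extend_subspace[OF B(2), of id] by auto
    have "p x = x" if "x \<in> V.span B" for x
      using VV.linear_eq_on[OF p(1) V.linear_ident that] p(2) by auto
    with p sp show ?thesis by auto
  qed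
  then obtain p where p: "Vector_Spaces.linear (scl V) (scl V) p" "\<And>x. x \<in> car V \<Longrightarrow> p x = x"
      "\<And>x. p x \<in> car V" by blast
  have "\<exists>q. Vector_Spaces.linear (scl W) (scl W) q \<and> (\<forall>x\<in>car W. q x = x) \<and> range q = car W"
  proof -
    obtain B where B: "B \<subseteq> car W" "W.independent B" "car W \<subseteq> W.span B"
      using W.maximal_independent_subset .
    then have sp: "W.span B = car W" using sW W.span_subspace by blast
    obtain q where q: "Vector_Spaces.linear (scl W) (scl W) q" "\<forall>x\<in>B. q x = x"
        "range q = W.span (id ` B)"
      using WW.linear_independent_extend_subspace[OF B(2), of id] by auto
    have "q x = x" if "x \<in> W.span B" for x
      using WW.linear_eq_on[OF q(1) W.linear_ident that] q(2) by auto
    with q sp show ?thesis by auto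
  qed
  then obtain q where q: "Vector_Spaces.linear (scl W) (scl W) q" "\<And>x. x \<in> car W \<Longrightarrow> q x = x"
      "\<And>x. q x \<in> car W" by blast

  have fl: "f (x + x') y = f x y + f x' y" "f (scl V c x) y = scl U c (f x y)" "f x y \<in> car U"
    if "x \<in> car V" "x' \<in> car V" "y \<in> car W" for x x' y c
    using f that unfolding bilinear_map_def linear_map_def by blast+
  have fr: "f x (y + y') = f x y + f x y'" "f x (scl W c y) = scl U c (f x y)"
    if "x \<in> car V" "y \<in> car W" "y' \<in> car W" for x y y' c
    using f that unfolding bilinear_map_def linear_map_def by blast+

  have fs: "f (scl V c x) y = scl U c (f x y)" "f x (scl W c y) = scl U c (f x y)"
    if "x \<in> car V" "y \<in> car W" for x y c
    using fl(2)[OF that(1) that(1) that(2)] fr(2)[OF that(1) that(2) that(2)] by blast+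

  have form: "bilinear_form (scl V) (scl W) (\<lambda>x y. l (f (p x) (q y)))"
    if l: "Vector_Spaces.linear (scl U) (*) l" for l
  proof -
    interpret l: Vector_Spaces.linear "scl U" "(*)" l by fact
    interpret p: Vector_Spaces.linear "scl V" "scl V" p by fact
    interpret q: Vector_Spaces.linear "scl W" "scl W" q by fact
    show ?thesis
      unfolding bilinear_form_def
      by (intro conjI allI; unfold_locales)
        (auto simp: p.add q.add p.scale q.scale fl(1) fr(1) fs p(3) q(3) l.add l.scale)
  qed

  let ?P = "{pure V W x y | x y. x \<in> car V \<and> y \<in> car W}"
  obtain B where B: "B \<subseteq> ?P" "F.independent B" "?P \<subseteq> F.span B"
    using F.maximal_independent_subset .
  have "\<forall>b\<in>B. \<exists>x y. b = pure V W x y \<and> x \<in> car V \<and> y \<in> car W" using B(1) by auto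
  then obtain X Y where XY: "\<And>b. b \<in> B \<Longrightarrow> b = pure V W (X b) (Y b)"
      "\<And>b. b \<in> B \<Longrightarrow> X b \<in> car V" "\<And>b. b \<in> B \<Longrightarrow> Y b \<in> car W"
    by metis
  obtain g where g: "Vector_Spaces.linear fscale (scl U) g" "\<And>b. b \<in> B \<Longrightarrow> g b = f (X b) (Y b)"
    using FU.linear_independent_extend[OF B(2), of "\<lambda>b. f (X b) (Y b)"] by auto
  interpret g: Vector_Spaces.linear "fscale :: 'k \<Rightarrow> (('v, 'w, 'k) tensor) \<Rightarrow> _" "scl U" g by fact
  have spB: "F.span B = F.span ?P"
    using F.span_mono[OF B(1)] F.span_minimal[OF B(3) F.subspace_span] by (rule subset_antisym)
  have key: "g t \<in> car U \<and>
      (\<forall>l. Vector_Spaces.linear (scl U) (*) l \<longrightarrow> l (g t) = t (\<lambda>x y. l (f (p x) (q y))))"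
    if "t \<in> F.span B" for t
    using that
  proof (induction t rule: F.span_induct_alt)
    case base
    have l: "l 0 = 0" if "Vector_Spaces.linear (scl U) (*) l" for l
      using that by (rule UK.linear_0)
    have "g 0 \<in> car U \<and> (\<forall>l. Vector_Spaces.linear (scl U) (*) l \<longrightarrow> l (g 0) = 0)"
      unfolding g.zero using U.subspace_0[OF sU] l by blast
    then show ?case unfolding zero_fun_apply .
  next
    case (step c b t)
    have gb: "g b = f (X b) (Y b)" by (rule g(2)[OF step(1)])
    have "g b \<in> car U" unfolding gb using XY(2,3)[OF step(1)] by (blast intro: fl(3))
    then have 1: "g (fscale c b + t) \<in> car U"
      using step sU by (simp add: g.add g.scale U.subspace_add U.subspace_scale)
    have 2: "l (g (fscale c b + t)) = (fscale c b + t) (\<lambda>x y. l (f (p x) (q y)))"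
      if l: "Vector_Spaces.linear (scl U) (*) l" for l
    proof -
      interpret l: Vector_Spaces.linear "scl U" "(*)" l by fact
      have "b (\<lambda>x y. l (f (p x) (q y))) = l (f (X b) (Y b))"
        by (subst XY(1)[OF step(1)]) (simp add: pure_def form[OF l] p(2) q(2) XY(2,3)[OF step(1)])
      moreover have "l (g (fscale c b + t)) = c * l (f (X b) (Y b)) + l (g t)"
        by (simp only: g.add g.scale l.add l.scale gb)
      ultimately show ?thesis
        using step l by (simp add: fscale_def)
    qed
    from 1 2 show ?case by blast
  qed
  have sep: "u = v" if "\<And>l. Vector_Spaces.linear (scl U) (*) l \<Longrightarrow> l u = l v" for u v
  proof (rule ccontr)
    assume "u \<noteq> v"
    then have "U.independent {u - v}" by simp
    from UK.linear_independent_extend[OF this, of "\<lambda>_. 1"] obtain l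
      where l: "Vector_Spaces.linear (scl U) (*) l" "l (u - v) = 1" by auto
    from UK.linear_diff[OF l(1), of u v] l(2) that[OF l(1)] show False by simp
  qed
  have gp: "g (pure V W x y) = f x y" if "x \<in> car V" "y \<in> car W" for x y
  proof (rule sep)
    fix l assume l: "Vector_Spaces.linear (scl U) (*) l"
    have "pure V W x y \<in> F.span B" using that B(3) by blast
    from key[OF this] l
    have "l (g (pure V W x y)) = pure V W x y (\<lambda>x y. l (f (p x) (q y)))" by blast
    also have "\<dots> = l (f x y)" by (simp add: pure_def form[OF l] p(2) q(2) that)
    finally show "l (g (pure V W x y)) = l (f x y)" .
  qed
  have gl: "linear_map (V \<otimes> W) U g"
    unfolding linear_map_def tensor_def using key by (simp add: spB g.add g.scale)
  have "\<exists>g. linear_map (V \<otimes> W) U g \<and> (\<forall>x\<in>car V. \<forall>y\<in>car W. g (pure V W x y) = f x y)"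
    using gl gp by blast
  note lift = someI_ex[OF this, folded tensor_lift_def]
  from lift show "linear_map (V \<otimes> W) U (tensor_lift V W U f)" by blast
  from lift show "x \<in> car V \<Longrightarrow> y \<in> car W \<Longrightarrow> tensor_lift V W U f (pure V W x y) = f x y" by blast
qed

definition tensor_map ::
    "('k::field, 'v::ab_group_add) vec \<Rightarrow> ('k, 'w::ab_group_add) vec
      \<Rightarrow> ('k, 'v'::ab_group_add) vec \<Rightarrow> ('k, 'w'::ab_group_add) vec
      \<Rightarrow> ('v \<Rightarrow> 'v') \<Rightarrow> ('w \<Rightarrow> 'w') \<Rightarrow> ('v, 'w, 'k) tensor \<Rightarrow> ('v', 'w', 'k) tensor" where
  "tensor_map V W V' W' f g = tensor_lift V W (V' \<otimes> W') (\<lambda>x y. pure V' W' (f x) (g y))"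

definition tensor_assoc ::
    "('k::field, 'u::ab_group_add) vec \<Rightarrow> ('k, 'v::ab_group_add) vec \<Rightarrow> ('k, 'w::ab_group_add) vec
      \<Rightarrow> (('u, 'v, 'k) tensor, 'w, 'k) tensor \<Rightarrow> ('u, ('v, 'w, 'k) tensor, 'k) tensor" where
  "tensor_assoc U V W = tensor_lift (U \<otimes> V) W (U \<otimes> (V \<otimes> W))
     (\<lambda>t z. tensor_lift U V (U \<otimes> (V \<otimes> W)) (\<lambda>x y. pure U (V \<otimes> W) x (pure V W y z)) t)"

text \<open>\<open>(V\<^sub>1 \<otimes> V\<^sub>2) \<otimes> (W\<^sub>1 \<otimes> W\<^sub>2) \<rightarrow> (V\<^sub>1 \<otimes> W\<^sub>1) \<otimes> (V\<^sub>2 \<otimes> W\<^sub>2)\<close>, exchanging the two middle factors.\<close>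

definition tensor_exchange ::
    "('k::field, 'a::ab_group_add) vec \<Rightarrow> ('k, 'b::ab_group_add) vec
      \<Rightarrow> ('k, 'c::ab_group_add) vec \<Rightarrow> ('k, 'd::ab_group_add) vec
      \<Rightarrow> (('a, 'b, 'k) tensor, ('c, 'd, 'k) tensor, 'k) tensor
      \<Rightarrow> (('a, 'c, 'k) tensor, ('b, 'd, 'k) tensor, 'k) tensor" where
  "tensor_exchange V1 V2 W1 W2 =
     (let U = (V1 \<otimes> W1) \<otimes> (V2 \<otimes> W2) in
      tensor_lift (V1 \<otimes> V2) (W1 \<otimes> W2) U
        (\<lambda>s t. tensor_lift V1 V2 U
           (\<lambda>x1 x2. tensor_lift W1 W2 U
              (\<lambda>y1 y2. pure (V1 \<otimes> W1) (V2 \<otimes> W2) (pure V1 W1 x1 y1) (pure V2 W2 x2 y2)) t) s))"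


section \<open>Species\<close>

text \<open>The finite sets are the finite subsets of a type \<^typ>\<open>'a\<close>.  If the type is infinite, they form,
  with the bijections between them, a category equivalent to that of all finite sets and bijections.
  A bijection \<open>I \<rightarrow> J\<close> is given by \<open>\<sigma>\<close> injective on \<open>I\<close> with \<open>J = \<sigma> ` I\<close>; only the restriction of \<open>\<sigma>\<close>
  to \<open>I\<close> matters.  The values of a species at infinite sets are irrelevant.\<close>

record ('a, 'k, 'v) species =
  obj :: "'a set \<Rightarrow> ('k, 'v) vec"
  act :: "('a \<Rightarrow> 'a) \<Rightarrow> 'a set \<Rightarrow> 'v \<Rightarrow> 'v"

record ('a, 'k, 'v) monoid_species = "('a, 'k, 'v) species" +
  mu :: "'a set \<Rightarrow> 'a set \<Rightarrow> ('v, 'v, 'k) tensor \<Rightarrow> 'v"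
  iota :: "'k \<Rightarrow> 'v"

record ('a, 'k, 'v) bimonoid_species = "('a, 'k, 'v) monoid_species" +
  Delta :: "'a set \<Rightarrow> 'a set \<Rightarrow> 'v \<Rightarrow> ('v, 'v, 'k) tensor"
  eps :: "'v \<Rightarrow> 'k"

locale species =
  fixes H :: "('a, 'k::field, 'v::ab_group_add, 'm) species_scheme"
  assumes vec: "finite I \<Longrightarrow> is_vec (obj H I)"
    and act_linear: "finite I \<Longrightarrow> inj_on \<sigma> I \<Longrightarrow> linear_map (obj H I) (obj H (\<sigma> ` I)) (act H \<sigma> I)"
    and act_cong: "finite I \<Longrightarrow> inj_on \<sigma> I \<Longrightarrow> (\<And>i. i \<in> I \<Longrightarrow> \<sigma> i = \<tau> i) \<Longrightarrow>
      x \<in> car (obj H I) \<Longrightarrow> act H \<sigma> I x = act H \<tau> I x"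
    and act_id: "finite I \<Longrightarrow> x \<in> car (obj H I) \<Longrightarrow> act H id I x = x"
    and act_comp: "finite I \<Longrightarrow> inj_on \<sigma> I \<Longrightarrow> inj_on \<tau> (\<sigma> ` I) \<Longrightarrow> x \<in> car (obj H I) \<Longrightarrow>
      act H (\<tau> \<circ> \<sigma>) I x = act H \<tau> (\<sigma> ` I) (act H \<sigma> I x)"

locale monoid_species = species H
  for H :: "('a, 'k::field, 'v::ab_group_add, 'm) monoid_species_scheme" +
  assumes mu_linear: "finite A \<Longrightarrow> finite B \<Longrightarrow> A \<inter> B = {} \<Longrightarrow>
      linear_map (obj H A \<otimes> obj H B) (obj H (A \<union> B)) (mu H A B)"
    and mu_natural: "finite A \<Longrightarrow> finite B \<Longrightarrow> A \<inter> B = {} \<Longrightarrow> inj_on \<sigma> (A \<union> B) \<Longrightarrow>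
      t \<in> car (obj H A \<otimes> obj H B) \<Longrightarrow>
      act H \<sigma> (A \<union> B) (mu H A B t) = mu H (\<sigma> ` A) (\<sigma> ` B)
        (tensor_map (obj H A) (obj H B) (obj H (\<sigma> ` A)) (obj H (\<sigma> ` B))
          (act H \<sigma> A) (act H \<sigma> B) t)"
    and mu_assoc: "finite A \<Longrightarrow> finite B \<Longrightarrow> finite C \<Longrightarrow>
      A \<inter> B = {} \<Longrightarrow> A \<inter> C = {} \<Longrightarrow> B \<inter> C = {} \<Longrightarrow>
      u \<in> car ((obj H A \<otimes> obj H B) \<otimes> obj H C) \<Longrightarrow>
      mu H (A \<union> B) C
        (tensor_map (obj H A \<otimes> obj H B) (obj H C) (obj H (A \<union> B)) (obj H C) (mu H A B) id u) =
      mu H A (B \<union> C)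
        (tensor_map (obj H A) (obj H B \<otimes> obj H C) (obj H A) (obj H (B \<union> C)) id (mu H B C)
          (tensor_assoc (obj H A) (obj H B) (obj H C) u))"
    and iota_linear: "linear_map ground (obj H {}) (iota H)"
    and mu_unit_left: "finite A \<Longrightarrow> x \<in> car (obj H A) \<Longrightarrow>
      mu H {} A (pure (obj H {}) (obj H A) (iota H 1) x) = x"
    and mu_unit_right: "finite A \<Longrightarrow> x \<in> car (obj H A) \<Longrightarrow>
      mu H A {} (pure (obj H A) (obj H {}) x (iota H 1)) = x"

locale comonoid_species = species H
  for H :: "('a, 'k::field, 'v::ab_group_add, 'm) bimonoid_species_scheme" +
  assumes Delta_linear: "finite A \<Longrightarrow> finite B \<Longrightarrow> A \<inter> B = {} \<Longrightarrow>
      linear_map (obj H (A \<union> B)) (obj H A \<otimes> obj H B) (Delta H A B)"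
    and Delta_natural: "finite A \<Longrightarrow> finite B \<Longrightarrow> A \<inter> B = {} \<Longrightarrow> inj_on \<sigma> (A \<union> B) \<Longrightarrow>
      x \<in> car (obj H (A \<union> B)) \<Longrightarrow>
      Delta H (\<sigma> ` A) (\<sigma> ` B) (act H \<sigma> (A \<union> B) x) =
        tensor_map (obj H A) (obj H B) (obj H (\<sigma> ` A)) (obj H (\<sigma> ` B))
          (act H \<sigma> A) (act H \<sigma> B) (Delta H A B x)"
    and Delta_coassoc: "finite A \<Longrightarrow> finite B \<Longrightarrow> finite C \<Longrightarrow>
      A \<inter> B = {} \<Longrightarrow> A \<inter> C = {} \<Longrightarrow> B \<inter> C = {} \<Longrightarrow>
      x \<in> car (obj H (A \<union> B \<union> C)) \<Longrightarrow>
      tensor_assoc (obj H A) (obj H B) (obj H C)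
        (tensor_map (obj H (A \<union> B)) (obj H C) (obj H A \<otimes> obj H B) (obj H C) (Delta H A B) id
          (Delta H (A \<union> B) C x)) =
      tensor_map (obj H A) (obj H (B \<union> C)) (obj H A) (obj H B \<otimes> obj H C) id (Delta H B C)
        (Delta H A (B \<union> C) x)"
    and eps_linear: "linear_map (obj H {}) ground (eps H)"
    and Delta_counit_left: "finite A \<Longrightarrow> x \<in> car (obj H A) \<Longrightarrow>
      tensor_map (obj H {}) (obj H A) ground (obj H A) (eps H) id (Delta H {} A x) =
        pure ground (obj H A) 1 x"
    and Delta_counit_right: "finite A \<Longrightarrow> x \<in> car (obj H A) \<Longrightarrow>
      tensor_map (obj H A) (obj H {}) (obj H A) ground id (eps H) (Delta H A {} x) =
        pure (obj H A) ground x 1"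

locale bimonoid_species = monoid_species H + comonoid_species H
  for H :: "('a, 'k::field, 'v::ab_group_add, 'm) bimonoid_species_scheme" +
  assumes Delta_mu: "finite A \<Longrightarrow> finite B \<Longrightarrow> A \<inter> B = {} \<Longrightarrow> C \<inter> D = {} \<Longrightarrow> A \<union> B = C \<union> D \<Longrightarrow>
      t \<in> car (obj H A \<otimes> obj H B) \<Longrightarrow>
      Delta H C D (mu H A B t) =
        tensor_map
          (obj H (A \<inter> C) \<otimes> obj H (B \<inter> C)) (obj H (A \<inter> D) \<otimes> obj H (B \<inter> D)) (obj H C) (obj H D)
          (mu H (A \<inter> C) (B \<inter> C)) (mu H (A \<inter> D) (B \<inter> D))
          (tensor_exchange (obj H (A \<inter> C)) (obj H (A \<inter> D)) (obj H (B \<inter> C)) (obj H (B \<inter> D))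
            (tensor_map
              (obj H A) (obj H B) (obj H (A \<inter> C) \<otimes> obj H (A \<inter> D)) (obj H (B \<inter> C) \<otimes> obj H (B \<inter> D))
              (Delta H (A \<inter> C) (A \<inter> D)) (Delta H (B \<inter> C) (B \<inter> D)) t))"
    and Delta_iota: "Delta H {} {} (iota H 1) = pure (obj H {}) (obj H {}) (iota H 1) (iota H 1)"
    and eps_mu: "x \<in> car (obj H {}) \<Longrightarrow> y \<in> car (obj H {}) \<Longrightarrow>
      eps H (mu H {} {} (pure (obj H {}) (obj H {}) x y)) = eps H x * eps H y"
    and eps_iota: "eps H (iota H 1) = 1"

definition species_morphism ::
    "('a, 'k::field, 'v::ab_group_add, 'm) species_scheme
      \<Rightarrow> ('a, 'k, 'w::ab_group_add, 'n) species_scheme \<Rightarrow> ('a set \<Rightarrow> 'v \<Rightarrow> 'w) \<Rightarrow> bool" where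
  "species_morphism G H \<alpha> \<longleftrightarrow>
     (\<forall>I. finite I \<longrightarrow> linear_map (obj G I) (obj H I) (\<alpha> I)) \<and>
     (\<forall>I \<sigma>. finite I \<and> inj_on \<sigma> I \<longrightarrow>
       (\<forall>x\<in>car (obj G I). \<alpha> (\<sigma> ` I) (act G \<sigma> I x) = act H \<sigma> I (\<alpha> I x)))"

definition monoid_morphism ::
    "('a, 'k::field, 'v::ab_group_add, 'm) monoid_species_scheme
      \<Rightarrow> ('a, 'k, 'w::ab_group_add, 'n) monoid_species_scheme \<Rightarrow> ('a set \<Rightarrow> 'v \<Rightarrow> 'w) \<Rightarrow> bool" where
  "monoid_morphism G H \<alpha> \<longleftrightarrow> species_morphism G H \<alpha> \<and>
     (\<forall>A B. finite A \<and> finite B \<and> A \<inter> B = {} \<longrightarrow>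
       (\<forall>t\<in>car (obj G A \<otimes> obj G B). \<alpha> (A \<union> B) (mu G A B t) =
          mu H A B (tensor_map (obj G A) (obj G B) (obj H A) (obj H B) (\<alpha> A) (\<alpha> B) t))) \<and>
     (\<forall>c. \<alpha> {} (iota G c) = iota H c)"

definition comonoid_morphism ::
    "('a, 'k::field, 'v::ab_group_add, 'm) bimonoid_species_scheme
      \<Rightarrow> ('a, 'k, 'w::ab_group_add, 'n) bimonoid_species_scheme \<Rightarrow> ('a set \<Rightarrow> 'v \<Rightarrow> 'w) \<Rightarrow> bool" where
  "comonoid_morphism G H \<alpha> \<longleftrightarrow> species_morphism G H \<alpha> \<and>
     (\<forall>A B. finite A \<and> finite B \<and> A \<inter> B = {} \<longrightarrow>
       (\<forall>x\<in>car (obj G (A \<union> B)). Delta H A B (\<alpha> (A \<union> B) x) =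
          tensor_map (obj G A) (obj G B) (obj H A) (obj H B) (\<alpha> A) (\<alpha> B) (Delta G A B x))) \<and>
     (\<forall>x\<in>car (obj G {}). eps H (\<alpha> {} x) = eps G x)"

text \<open>The antipode is an inverse of the identity for the convolution product; the unit of convolution,
  \<open>\<iota> \<circ> \<epsilon>\<close>, vanishes on non-empty sets.\<close>

definition antipode ::
    "('a, 'k::field, 'v::ab_group_add, 'm) bimonoid_species_scheme
      \<Rightarrow> ('a set \<Rightarrow> 'v \<Rightarrow> 'v) \<Rightarrow> bool" where
  "antipode H S \<longleftrightarrow> species_morphism H H S \<and>
     (\<forall>I. finite I \<longrightarrow> (\<forall>x\<in>car (obj H I).
       (\<Sum>A\<in>Pow I. mu H A (I - A)
          (tensor_map (obj H A) (obj H (I - A)) (obj H A) (obj H (I - A)) (S A) id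
            (Delta H A (I - A) x))) = (if I = {} then iota H (eps H x) else 0) \<and>
       (\<Sum>A\<in>Pow I. mu H A (I - A)
          (tensor_map (obj H A) (obj H (I - A)) (obj H A) (obj H (I - A)) id (S (I - A))
            (Delta H A (I - A) x))) = (if I = {} then iota H (eps H x) else 0)))"

locale hopf_monoid = bimonoid_species H
  for H :: "('a, 'k::field, 'v::ab_group_add, 'm) bimonoid_species_scheme" +
  assumes antipode_exists: "\<exists>S. antipode H S"

definition hopf_morphism ::
    "('a, 'k::field, 'v::ab_group_add, 'm) bimonoid_species_scheme
      \<Rightarrow> ('a, 'k, 'w::ab_group_add, 'n) bimonoid_species_scheme \<Rightarrow> ('a set \<Rightarrow> 'v \<Rightarrow> 'w) \<Rightarrow> bool" where
  "hopf_morphism G H \<alpha> \<longleftrightarrow> monoid_morphism G H \<alpha> \<and> comonoid_morphism G H \<alpha>"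


section \<open>Characters\<close>

definition exp_species :: "('a, 'k::field, 'k) monoid_species" where
  "exp_species = \<lparr>obj = (\<lambda>_. ground), act = (\<lambda>_ _. id),
     mu = (\<lambda>_ _. tensor_lift ground ground ground (*)), iota = id\<rparr>"

definition character ::
    "('a, 'k::field, 'v::ab_group_add, 'm) bimonoid_species_scheme \<Rightarrow> ('a set \<Rightarrow> 'v \<Rightarrow> 'k) \<Rightarrow> bool" where
  "character H \<eta> \<longleftrightarrow> monoid_morphism H exp_species \<eta> \<and> (\<forall>x\<in>car (obj H {}). \<eta> {} x = eps H x)"

text \<open>Morphisms are not constrained at infinite sets and outside the carriers, so a morphism is only
  unique as a HOL function once it is required to be extensional (\<open>\<Pi>\<^sub>E\<close>, \<open>\<rightarrow>\<^sub>E\<close>).\<close>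

definition comb_hopf_morphism ::
    "('a, 'k::field, 'v::ab_group_add, 'm) bimonoid_species_scheme \<Rightarrow> ('a set \<Rightarrow> 'v \<Rightarrow> 'k)
      \<Rightarrow> ('a, 'k, 'w::ab_group_add, 'n) bimonoid_species_scheme \<Rightarrow> ('a set \<Rightarrow> 'w \<Rightarrow> 'k)
      \<Rightarrow> ('a set \<Rightarrow> 'v \<Rightarrow> 'w) \<Rightarrow> bool" where
  "comb_hopf_morphism G \<eta> H \<theta> \<alpha> \<longleftrightarrow> hopf_morphism G H \<alpha> \<and>
     (\<forall>I. finite I \<longrightarrow> (\<forall>x\<in>car (obj G I). \<theta> I (\<alpha> I x) = \<eta> I x))"


section \<open>Word quasisymmetric functions\<close>

definition set_compositions :: "'a set \<Rightarrow> 'a set list set" where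
  "set_compositions I = {\<pi>. {} \<notin> set \<pi> \<and> sorted_wrt disjnt \<pi> \<and> \<Union>(set \<pi>) = I}"

definition restrict_comp :: "'a set list \<Rightarrow> 'a set \<Rightarrow> 'a set list" where
  "restrict_comp \<pi> A = filter (\<lambda>S. S \<noteq> {}) (map (\<lambda>S. S \<inter> A) \<pi>)"

lemma finite_set_compositions: "finite I \<Longrightarrow> finite (set_compositions I)"
proof -
  assume "finite I"
  have "distinct \<pi>" if "\<pi> \<in> set_compositions I" for \<pi>
  proof -
    have "sorted_wrt disjnt \<pi>" "{} \<notin> set \<pi>" using that by (auto simp: set_compositions_def)
    then show ?thesis by (induction \<pi>) (auto simp: disjnt_def)
  qed
  then have "set_compositions I \<subseteq> {\<pi>. set \<pi> \<subseteq> Pow I \<and> distinct \<pi>}"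
    by (auto simp: set_compositions_def)
  then show ?thesis
    using finite_subset_distinct[of "Pow I"] \<open>finite I\<close> by (meson finite_Pow_iff finite_subset)
qed

text \<open>A vector with basis indexed by set compositions is its coefficient function; the basis vector
  \<open>M\<^sub>\<pi>\<close> is an indicator, and \<open>basis_extend U I F\<close> is the linear map with \<open>M\<^sub>\<pi> \<mapsto> F \<pi>\<close> for the set
  compositions \<open>\<pi>\<close> of \<open>I\<close>.\<close>

definition mono_basis :: "'a set list \<Rightarrow> 'a set list \<Rightarrow> 'k::field" where
  "mono_basis \<pi> = (\<lambda>\<tau>. if \<tau> = \<pi> then 1 else 0)"

definition wqsym_obj :: "'a set \<Rightarrow> ('k::field, 'a set list \<Rightarrow> 'k) vec" where
  "wqsym_obj I = \<lparr>scl = fscale, car = module.span fscale (mono_basis ` set_compositions I)\<rparr>"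

definition basis_extend ::
    "('k::field, 'u::ab_group_add) vec \<Rightarrow> 'a set \<Rightarrow> ('a set list \<Rightarrow> 'u) \<Rightarrow> ('a set list \<Rightarrow> 'k) \<Rightarrow> 'u" where
  "basis_extend U I F f = (\<Sum>\<pi>\<in>set_compositions I. scl U (f \<pi>) (F \<pi>))"

definition WQSym :: "('a, 'k::field, 'a set list \<Rightarrow> 'k) bimonoid_species" where
  "WQSym = \<lparr>
     obj = wqsym_obj,
     act = (\<lambda>\<sigma> I. basis_extend (wqsym_obj (\<sigma> ` I)) I (\<lambda>\<pi>. mono_basis (map ((`) \<sigma>) \<pi>))),
     mu = (\<lambda>A B. tensor_lift (wqsym_obj A) (wqsym_obj B) (wqsym_obj (A \<union> B))
       (\<lambda>f g. basis_extend (wqsym_obj (A \<union> B)) A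
          (\<lambda>\<pi>. basis_extend (wqsym_obj (A \<union> B)) B
             (\<lambda>\<tau>. \<Sum>\<gamma> | \<gamma> \<in> set_compositions (A \<union> B) \<and>
                 restrict_comp \<gamma> A = \<pi> \<and> restrict_comp \<gamma> B = \<tau>. mono_basis \<gamma>) g) f)),
     iota = (\<lambda>c. fscale c (mono_basis [])),
     Delta = (\<lambda>A B. basis_extend (wqsym_obj A \<otimes> wqsym_obj B) (A \<union> B)
       (\<lambda>\<pi>. if \<forall>p<length \<pi>. \<forall>q<length \<pi>. \<pi> ! p \<inter> A \<noteq> {} \<and> \<pi> ! q \<inter> B \<noteq> {} \<longrightarrow> p < q
            then pure (wqsym_obj A) (wqsym_obj B)
              (mono_basis (restrict_comp \<pi> A)) (mono_basis (restrict_comp \<pi> B))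
            else 0)),
     eps = basis_extend ground {} (\<lambda>\<pi>. if \<pi> = [] then 1 else 0)\<rparr>"

definition eta0 :: "'a set \<Rightarrow> ('a set list \<Rightarrow> 'k::field) \<Rightarrow> 'k" where
  "eta0 I = basis_extend ground I (\<lambda>\<pi>. if length \<pi> \<le> 1 then 1 else 0)"

end

theory Submission
  imports Defs
begin

text \<open>
  A set composition \<open>\<pi> = S\<^sub>1|\<dots>|S\<^sub>l\<close> of \<open>I\<close> yields the linear form
  \<open>\<eta>\<^sub>\<pi> = (\<eta> \<otimes> \<dots> \<otimes> \<eta>) \<circ> \<Delta>\<^bsub>S\<^sub>1,\<dots>,S\<^sub>l\<^esub>\<close> on \<open>h[I]\<close>, an iterated convolution of \<open>\<eta>\<close>.
  For WQSym with \<open>\<eta>\<^sub>0\<close> this form is the coefficient of \<open>M\<^sub>\<pi>\<close>, and comonoid morphisms are compatible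
  with convolution, so every combinatorial morphism must send \<open>x\<close> to \<open>\<Sum>\<^sub>\<pi> \<eta>\<^sub>\<pi>(x) M\<^sub>\<pi>\<close>.
  This formula does define a morphism: coassociativity gives \<open>\<eta>\<^bsub>\<pi>\<tau>\<^esub> = \<eta>\<^sub>\<pi> * \<eta>\<^sub>\<tau>\<close> for concatenations, hence
  compatibility with \<open>\<Delta>\<close>; the bimonoid axiom turns \<open>\<eta>\<^sub>\<gamma>(x \<cdot> y)\<close> into the product of the forms of the
  blockwise intersections of \<open>\<gamma>\<close> with \<open>A\<close> and \<open>B\<close>.  Empty blocks may be deleted from these since
  \<open>\<eta>\<^sub>\<emptyset> = \<epsilon>\<^sub>\<emptyset>\<close>; this replaces connectedness.
\<close>

section \<open>Tensor products of linear maps\<close>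

lemma linear_mapD:
  assumes "linear_map V W f"
  shows "x \<in> car V \<Longrightarrow> f x \<in> car W"
    and "x \<in> car V \<Longrightarrow> y \<in> car V \<Longrightarrow> f (x + y) = f x + f y"
    and "x \<in> car V \<Longrightarrow> f (scl V c x) = scl W c (f x)"
  using assms unfolding linear_map_def by auto

lemma linear_map_comp:
  assumes "linear_map V W f" and "linear_map W U g"
  shows "linear_map V U (\<lambda>x. g (f x))"
  using assms unfolding linear_map_def by (auto simp: Pi_iff)

lemma linear_map_id: "linear_map V V id" "linear_map V V (\<lambda>x. x)"
  unfolding linear_map_def by auto

lemma linear_map_zero:
  assumes "linear_map V W f" and "is_vec V" and "is_vec W"
  shows "f 0 = 0"
proof -
  interpret V: vector_space "scl V" using assms(2) by (simp add: is_vec_def)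
  interpret W: vector_space "scl W" using assms(3) by (simp add: is_vec_def)
  have "0 \<in> car V" using assms(2) V.subspace_0 by (simp add: is_vec_def)
  from linear_mapD(3)[OF assms(1) this, of 0] show ?thesis by simp
qed

lemma is_vec_closed:
  assumes "is_vec V"
  shows "0 \<in> car V" "x \<in> car V \<Longrightarrow> y \<in> car V \<Longrightarrow> x + y \<in> car V"
    "x \<in> car V \<Longrightarrow> scl V c x \<in> car V"
proof -
  interpret V: vector_space "scl V" using assms by (simp add: is_vec_def)
  have "V.subspace (car V)" using assms by (simp add: is_vec_def)
  then show "0 \<in> car V" "x \<in> car V \<Longrightarrow> y \<in> car V \<Longrightarrow> x + y \<in> car V"
    "x \<in> car V \<Longrightarrow> scl V c x \<in> car V"
    by (auto intro: V.subspace_0 V.subspace_add V.subspace_scale)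
qed

lemma linear_map_cong:
  assumes "linear_map V W f" and "is_vec V" and "\<And>x. x \<in> car V \<Longrightarrow> f x = g x"
  shows "linear_map V W g"
  using assms(1) is_vec_closed[OF assms(2)] assms(3)[symmetric]
  unfolding linear_map_def by (simp add: Pi_iff)

lemma is_vec_sum:
  assumes "is_vec V" and "\<And>i. i \<in> A \<Longrightarrow> f i \<in> car V"
  shows "sum f A \<in> car V"
  using assms(2) by (induction A rule: infinite_finite_induct) (auto intro: is_vec_closed[OF assms(1)])

lemma linear_map_sum:
  assumes "linear_map V W f" and "is_vec V" and "is_vec W" and "\<And>i. i \<in> A \<Longrightarrow> g i \<in> car V"
  shows "f (sum g A) = (\<Sum>i\<in>A. f (g i))"
  using assms(4)
proof (induction A rule: infinite_finite_induct)
  case (insert i A)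
  then have "f (g i + sum g A) = f (g i) + f (sum g A)"
    by (intro linear_mapD(2)[OF assms(1)] is_vec_sum[OF assms(2)]) auto
  then show ?case using insert by simp
qed (auto simp: linear_map_zero[OF assms(1-3)])

lemma is_vec_ground: "is_vec ground"
proof -
  interpret K: vector_space "(*) :: 'a::field \<Rightarrow> 'a \<Rightarrow> 'a" by (rule vector_space_times)
  show ?thesis
    unfolding is_vec_def ground_def by (simp only: vec.simps vector_space_times K.subspace_UNIV)
qed

lemma ground_simps [simp]: "scl ground = (*)" "car ground = UNIV"
  by (simp_all add: ground_def)

lemma scl_tensor [simp]: "scl (V \<otimes> W) = fscale"
  by (simp add: tensor_def)

text \<open>Since \<open>pure V W x y\<close> evaluates forms at \<open>(x, y)\<close>, its
  bilinearity is inherited from each bilinear form; at all other arguments every pure tensor is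
  0.\<close>

lemma bilinear_map_pure:
  assumes "is_vec V" and "is_vec W"
  shows "bilinear_map V W (V \<otimes> W) (pure V W)"
proof -
  have l: "B (x + x') y = B x y + B x' y" "B (scl V c x) y = c * B x y"
    "B x (y + y') = B x y + B x y'" "B x (scl W c y) = c * B x y"
    if "bilinear_form (scl V) (scl W) B" for B x x' y y' c
  proof -
    have "\<And>y. Vector_Spaces.linear (scl V) (*) (\<lambda>x. B x y)"
      "\<And>x. Vector_Spaces.linear (scl W) (*) (B x)"
      using that unfolding bilinear_form_def by blast+
    then show "B (x + x') y = B x y + B x' y" "B (scl V c x) y = c * B x y"
      "B x (y + y') = B x y + B x y'" "B x (scl W c y) = c * B x y"
      by (auto simp: Vector_Spaces.linear_iff)
  qed
  show ?thesis
    unfolding bilinear_map_def linear_map_def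
    \<comment> \<open>Membership is settled first, because unfolding \<open>pure\<close> would hide
      that the values are pure tensors.\<close>
    by (intro conjI ballI allI)
      (auto simp: pure_in_tensor, auto simp: pure_def fun_eq_iff fscale_def l)
qed

lemma linear_map_pure:
  assumes "is_vec V" "is_vec W"
  shows "y \<in> car W \<Longrightarrow> linear_map V (V \<otimes> W) (\<lambda>x. pure V W x y)"
    and "x \<in> car V \<Longrightarrow> linear_map W (V \<otimes> W) (pure V W x)"
  using bilinear_map_pure[OF assms] unfolding bilinear_map_def by auto

lemma bilinear_map_comp:
  assumes "bilinear_map V' W' U f" and "linear_map V V' a" and "linear_map W W' b"
  shows "bilinear_map V W U (\<lambda>x y. f (a x) (b y))"
  unfolding bilinear_map_def
proof (intro conjI ballI)
  fix y assume "y \<in> car W"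
  then have "linear_map V' U (\<lambda>x. f x (b y))"
    using assms(1) linear_mapD(1)[OF assms(3)] unfolding bilinear_map_def by blast
  from linear_map_comp[OF assms(2) this] show "linear_map V U (\<lambda>x. f (a x) (b y))" .
next
  fix x assume "x \<in> car V"
  then have "linear_map W' U (f (a x))"
    using assms(1) linear_mapD(1)[OF assms(2)] unfolding bilinear_map_def by blast
  from linear_map_comp[OF assms(3) this] show "linear_map W U (\<lambda>y. f (a x) (b y))" .
qed

lemma tensor_map_linear:
  assumes "is_vec V" "is_vec W" "is_vec V'" "is_vec W'" "linear_map V V' a" "linear_map W W' b"
  shows "linear_map (V \<otimes> W) (V' \<otimes> W') (tensor_map V W V' W' a b)"
    and "x \<in> car V \<Longrightarrow> y \<in> car W \<Longrightarrow> tensor_map V W V' W' a b (pure V W x y) = pure V' W' (a x) (b y)"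
proof -
  note B = bilinear_map_comp[OF bilinear_map_pure[OF assms(3,4)] assms(5,6)]
  note L = tensor_lift_universal[OF assms(1,2) is_vec_tensor B, folded tensor_map_def]
  show "linear_map (V \<otimes> W) (V' \<otimes> W') (tensor_map V W V' W' a b)"
    by (rule L(1))
  show "tensor_map V W V' W' a b (pure V W x y) = pure V' W' (a x) (b y)"
    if "x \<in> car V" "y \<in> car W"
    by (rule L(2)[OF that])
qed

section \<open>Nested universal maps: associativity and exchange of factors\<close>

text \<open>As \<open>tensor_lift\<close> is a choice, its dependence on a parameter
  \<open>z\<close> is not visible from the definition. For fixed parameters both sides of additivity
  are linear in \<open>t\<close> and agree on pure tensors, hence agree by uniqueness; scaling is
  the same. This makes nested lifts tractable.\<close>

lemma tensor_lift_parameter: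
  assumes vec: "is_vec U" "is_vec V" "is_vec X" "is_vec Z"
    and f: "\<And>z. z \<in> car Z \<Longrightarrow> bilinear_map U V X (f z)"
    and lin: "\<And>x y. x \<in> car U \<Longrightarrow> y \<in> car V \<Longrightarrow> linear_map Z X (\<lambda>z. f z x y)"
    and t: "t \<in> car (U \<otimes> V)"
  shows "linear_map Z X (\<lambda>z. tensor_lift U V X (f z) t)"
proof -
  note L = tensor_lift_universal[OF vec(1-3) f]
  interpret X: vector_space "scl X" using vec(3) by (simp add: is_vec_def)
  have mem: "tensor_lift U V X (f z) s \<in> car X" if "z \<in> car Z" "s \<in> car (U \<otimes> V)" for z s
    using linear_mapD(1)[OF L(1)] that .
  have "tensor_lift U V X (f (z + z')) t = tensor_lift U V X (f z) t + tensor_lift U V X (f z') t"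
    if z: "z \<in> car Z" "z' \<in> car Z" for z z'
  proof (rule tensor_map_unique[OF vec(3) _ _ _ t])
    have zz: "z + z' \<in> car Z" by (rule is_vec_closed(2)[OF vec(4) z])
    then show "linear_map (U \<otimes> V) X (tensor_lift U V X (f (z + z')))" by (rule L)
    show "linear_map (U \<otimes> V) X (\<lambda>t. tensor_lift U V X (f z) t + tensor_lift U V X (f z') t)"
      using L(1)[OF z(1)] L(1)[OF z(2)]
      by (auto simp: linear_map_def Pi_iff is_vec_closed[OF vec(3)] X.scale_right_distrib)
    show "tensor_lift U V X (f (z + z')) (pure U V x y) =
        tensor_lift U V X (f z) (pure U V x y) + tensor_lift U V X (f z') (pure U V x y)"
      if "x \<in> car U" "y \<in> car V" for x y
      by (simp add: L(2) z zz that linear_mapD(2)[OF lin])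
  qed
  moreover have "tensor_lift U V X (f (scl Z c z)) t = scl X c (tensor_lift U V X (f z) t)"
    if z: "z \<in> car Z" for z c
  proof (rule tensor_map_unique[OF vec(3) _ _ _ t])
    have zz: "scl Z c z \<in> car Z" by (rule is_vec_closed(3)[OF vec(4) z])
    then show "linear_map (U \<otimes> V) X (tensor_lift U V X (f (scl Z c z)))" by (rule L)
    show "linear_map (U \<otimes> V) X (\<lambda>t. scl X c (tensor_lift U V X (f z) t))"
      using L(1)[OF z]
      by (auto simp: linear_map_def Pi_iff is_vec_closed[OF vec(3)] X.scale_right_distrib
          X.scale_left_commute)
    show "tensor_lift U V X (f (scl Z c z)) (pure U V x y) =
        scl X c (tensor_lift U V X (f z) (pure U V x y))"
      if "x \<in> car U" "y \<in> car V" for x y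
      by (simp add: L(2) z zz that linear_mapD(3)[OF lin])
  qed
  ultimately show ?thesis
    unfolding linear_map_def using mem t by blast
qed

lemma tensor_lift_parameter_bilinear:
  assumes vec: "is_vec U" "is_vec V" "is_vec X" "is_vec Z"
    and f: "\<And>z. z \<in> car Z \<Longrightarrow> bilinear_map U V X (f z)"
    and lin: "\<And>x y. x \<in> car U \<Longrightarrow> y \<in> car V \<Longrightarrow> linear_map Z X (\<lambda>z. f z x y)"
  shows "bilinear_map (U \<otimes> V) Z X (\<lambda>t z. tensor_lift U V X (f z) t)"
  unfolding bilinear_map_def
proof (intro conjI ballI)
  show "linear_map (U \<otimes> V) X (\<lambda>t. tensor_lift U V X (f z) t)" if "z \<in> car Z" for z
    by (rule tensor_lift_universal(1)[OF vec(1-3) f[OF that]])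
  show "linear_map Z X (\<lambda>z. tensor_lift U V X (f z) t)" if "t \<in> car (U \<otimes> V)" for t
    by (rule tensor_lift_parameter[OF vec f lin that])
qed

text \<open>The inner lift of the definition has \<open>z\<close> as a parameter; linear dependence
  on it supplies the bilinearity that the outer lift requires.\<close>

lemma tensor_assoc_linear:
  assumes vec: "is_vec U" "is_vec V" "is_vec W"
  shows "linear_map ((U \<otimes> V) \<otimes> W) (U \<otimes> (V \<otimes> W)) (tensor_assoc U V W)"
    and "x \<in> car U \<Longrightarrow> y \<in> car V \<Longrightarrow> z \<in> car W \<Longrightarrow>
      tensor_assoc U V W (pure (U \<otimes> V) W (pure U V x y) z) = pure U (V \<otimes> W) x (pure V W y z)"
proof -
  let ?F = "\<lambda>z x y. pure U (V \<otimes> W) x (pure V W y z)"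
  have p: "bilinear_map U (V \<otimes> W) (U \<otimes> (V \<otimes> W)) (pure U (V \<otimes> W))"
    by (rule bilinear_map_pure[OF vec(1) is_vec_tensor])
  have f: "bilinear_map U V (U \<otimes> (V \<otimes> W)) (?F z)" if "z \<in> car W" for z
    by (rule bilinear_map_comp[OF p linear_map_id(2) linear_map_pure(1)[OF vec(2,3) that]])
  have l: "linear_map W (U \<otimes> (V \<otimes> W)) (\<lambda>z. ?F z x y)" if "x \<in> car U" "y \<in> car V" for x y
    by (rule linear_map_comp[OF linear_map_pure(2)[OF vec(2,3) that(2)]
          linear_map_pure(2)[OF vec(1) is_vec_tensor that(1)]])
  have B: "bilinear_map (U \<otimes> V) W (U \<otimes> (V \<otimes> W)) (\<lambda>t z. tensor_lift U V (U \<otimes> (V \<otimes> W)) (?F z) t)"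
    by (rule tensor_lift_parameter_bilinear[OF vec(1,2) is_vec_tensor vec(3)]) (fact f l)+
  note L = tensor_lift_universal[OF is_vec_tensor vec(3) is_vec_tensor B, folded tensor_assoc_def]
  show "linear_map ((U \<otimes> V) \<otimes> W) (U \<otimes> (V \<otimes> W)) (tensor_assoc U V W)"
    by (rule L(1))
  show "tensor_assoc U V W (pure (U \<otimes> V) W (pure U V x y) z) = pure U (V \<otimes> W) x (pure V W y z)"
    if "x \<in> car U" "y \<in> car V" "z \<in> car W"
    using L(2)[OF pure_in_tensor[OF that(1,2)] that(3)]
      tensor_lift_universal(2)[OF vec(1,2) is_vec_tensor f[OF that(3)] that(1,2)]
    by simp
qed

lemma tensor_exchange_linear:
  assumes vec: "is_vec V1" "is_vec V2" "is_vec W1" "is_vec W2"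
  shows "linear_map ((V1 \<otimes> V2) \<otimes> (W1 \<otimes> W2)) ((V1 \<otimes> W1) \<otimes> (V2 \<otimes> W2)) (tensor_exchange V1 V2 W1 W2)"
    and "x1 \<in> car V1 \<Longrightarrow> x2 \<in> car V2 \<Longrightarrow> y1 \<in> car W1 \<Longrightarrow> y2 \<in> car W2 \<Longrightarrow>
      tensor_exchange V1 V2 W1 W2 (pure (V1 \<otimes> V2) (W1 \<otimes> W2) (pure V1 V2 x1 x2) (pure W1 W2 y1 y2)) =
      pure (V1 \<otimes> W1) (V2 \<otimes> W2) (pure V1 W1 x1 y1) (pure V2 W2 x2 y2)"
proof -
  let ?U = "(V1 \<otimes> W1) \<otimes> (V2 \<otimes> W2)"
  let ?F = "\<lambda>x1 x2 y1 y2. pure (V1 \<otimes> W1) (V2 \<otimes> W2) (pure V1 W1 x1 y1) (pure V2 W2 x2 y2)"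
  have p: "bilinear_map (V1 \<otimes> W1) (V2 \<otimes> W2) ?U (pure (V1 \<otimes> W1) (V2 \<otimes> W2))"
    by (rule bilinear_map_pure[OF is_vec_tensor is_vec_tensor])
  have f: "bilinear_map W1 W2 ?U (?F x1 x2)" if "x1 \<in> car V1" "x2 \<in> car V2" for x1 x2
    by (rule bilinear_map_comp[OF p linear_map_pure(2)[OF vec(1,3) that(1)]
          linear_map_pure(2)[OF vec(2,4) that(2)]])
  have g: "bilinear_map V1 V2 ?U (\<lambda>x1 x2. ?F x1 x2 y1 y2)" if "y1 \<in> car W1" "y2 \<in> car W2" for y1 y2
    by (rule bilinear_map_comp[OF p linear_map_pure(1)[OF vec(1,3) that(1)]
          linear_map_pure(1)[OF vec(2,4) that(2)]])
  \<comment> \<open>\<open>?G t\<close> is the innermost lift as a function of its parameters, so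
    its bilinearity is linear dependence on each of \<open>x1\<close> and \<open>x2\<close> in
    turn.\<close>
  let ?G = "\<lambda>t x1 x2. tensor_lift W1 W2 ?U (?F x1 x2) t"
  have G: "bilinear_map V1 V2 ?U (?G t)" if "t \<in> car (W1 \<otimes> W2)" for t
    unfolding bilinear_map_def
  proof (intro conjI ballI)
    fix x2 assume "x2 \<in> car V2"
    then show "linear_map V1 ?U (\<lambda>x1. ?G t x1 x2)"
      using f g that
      by (intro tensor_lift_parameter[OF vec(3,4) is_vec_tensor vec(1)])
        (auto simp: bilinear_map_def)
  next
    fix x1 assume "x1 \<in> car V1"
    then show "linear_map V2 ?U (?G t x1)"
      using f g that
      by (intro tensor_lift_parameter[OF vec(3,4) is_vec_tensor vec(2)])
        (auto simp: bilinear_map_def)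
  qed
  have B: "bilinear_map (V1 \<otimes> V2) (W1 \<otimes> W2) ?U (\<lambda>s t. tensor_lift V1 V2 ?U (?G t) s)"
    by (rule tensor_lift_parameter_bilinear[OF vec(1,2) is_vec_tensor is_vec_tensor])
      (fact G tensor_lift_universal(1)[OF vec(3,4) is_vec_tensor f])+
  note L = tensor_lift_universal[OF is_vec_tensor is_vec_tensor is_vec_tensor B]
  have e: "tensor_exchange V1 V2 W1 W2 =
      tensor_lift (V1 \<otimes> V2) (W1 \<otimes> W2) ?U (\<lambda>s t. tensor_lift V1 V2 ?U (?G t) s)"
    by (simp add: tensor_exchange_def Let_def)
  show "linear_map ((V1 \<otimes> V2) \<otimes> (W1 \<otimes> W2)) ?U (tensor_exchange V1 V2 W1 W2)"
    unfolding e by (rule L(1))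
  show "tensor_exchange V1 V2 W1 W2 (pure (V1 \<otimes> V2) (W1 \<otimes> W2) (pure V1 V2 x1 x2) (pure W1 W2 y1 y2)) =
      ?F x1 x2 y1 y2"
    if "x1 \<in> car V1" "x2 \<in> car V2" "y1 \<in> car W1" "y2 \<in> car W2"
    unfolding e
    using L(2)[OF pure_in_tensor[OF that(1,2)] pure_in_tensor[OF that(3,4)]]
      tensor_lift_universal(2)[OF vec(1,2) is_vec_tensor G[OF pure_in_tensor[OF that(3,4)]] that(1,2)]
      tensor_lift_universal(2)[OF vec(3,4) is_vec_tensor f[OF that(1,2)] that(3,4)]
    by simp
qed

section \<open>Linear forms on tensor products\<close>

text \<open>This is \<open>f \<otimes> g\<close> followed by the identification of the tensor square
  of the field with the field. Pairing with such forms turns identities between tensors into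
  identities between scalars.\<close>

definition tensor_form ::
    "('k::field, 'v::ab_group_add) vec \<Rightarrow> ('k, 'w::ab_group_add) vec
      \<Rightarrow> ('v \<Rightarrow> 'k) \<Rightarrow> ('w \<Rightarrow> 'k) \<Rightarrow> ('v, 'w, 'k) tensor \<Rightarrow> 'k" where
  "tensor_form V W f g = tensor_lift V W ground (\<lambda>x y. f x * g y)"

lemma tensor_form_linear:
  assumes "is_vec V" "is_vec W" "linear_map V ground f" "linear_map W ground g"
  shows "linear_map (V \<otimes> W) ground (tensor_form V W f g)"
    and "x \<in> car V \<Longrightarrow> y \<in> car W \<Longrightarrow> tensor_form V W f g (pure V W x y) = f x * g y"
proof -
  have "bilinear_map V W ground (\<lambda>x y. f x * g y)"
    using assms(3,4) unfolding bilinear_map_def linear_map_def by (auto simp: algebra_simps)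
  from tensor_lift_universal[OF assms(1,2) is_vec_ground this, folded tensor_form_def]
  show "linear_map (V \<otimes> W) ground (tensor_form V W f g)"
    and "x \<in> car V \<Longrightarrow> y \<in> car W \<Longrightarrow> tensor_form V W f g (pure V W x y) = f x * g y" .
qed

text \<open>Forms are functions on the whole ambient type, so forms that agree on the carriers need
  not be equal and cannot simply be rewritten. Agreement on pure tensors and uniqueness bridge
  this.\<close>

lemma tensor_form_cong:
  assumes "is_vec V" "is_vec W" "linear_map V ground f" "linear_map W ground g"
    and "\<And>x. x \<in> car V \<Longrightarrow> f x = f' x" and "\<And>y. y \<in> car W \<Longrightarrow> g y = g' y"
    and t: "t \<in> car (V \<otimes> W)"
  shows "tensor_form V W f g t = tensor_form V W f' g' t"
proof -
  have "linear_map V ground f'" "linear_map W ground g'"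
    using linear_map_cong assms by metis+
  note f = tensor_form_linear[OF assms(1-4)] and g = tensor_form_linear[OF assms(1,2) this]
  show ?thesis
    by (rule tensor_map_unique[OF is_vec_ground f(1) g(1) _ t]) (simp add: f(2) g(2) assms(5,6))
qed

text \<open>Functoriality, checked on pure tensors. It moves a map from a tensor into the two forms
  and serves for products, coproducts, counits, relabellings and morphisms alike.\<close>

lemma tensor_form_map:
  assumes vec: "is_vec V" "is_vec W" "is_vec V'" "is_vec W'"
    and a: "linear_map V V' a" and b: "linear_map W W' b"
    and f: "linear_map V' ground f" and g: "linear_map W' ground g"
    and t: "t \<in> car (V \<otimes> W)"
  shows "tensor_form V' W' f g (tensor_map V W V' W' a b t) =
    tensor_form V W (\<lambda>x. f (a x)) (\<lambda>y. g (b y)) t"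
proof -
  note m = tensor_map_linear[OF vec a b]
    and l = tensor_form_linear[OF vec(3,4) f g]
    and r = tensor_form_linear[OF vec(1,2) linear_map_comp[OF a f] linear_map_comp[OF b g]]
  show ?thesis
    by (rule tensor_map_unique[OF is_vec_ground linear_map_comp[OF m(1) l(1)] r(1) _ t])
      (simp add: m(2) l(2) r(2) linear_mapD(1)[OF a] linear_mapD(1)[OF b])
qed

lemma tensor_form_assoc:
  assumes vec: "is_vec U" "is_vec V" "is_vec W"
    and f: "linear_map U ground f" and g: "linear_map V ground g" and h: "linear_map W ground h"
    and u: "u \<in> car ((U \<otimes> V) \<otimes> W)"
  shows "tensor_form U (V \<otimes> W) f (tensor_form V W g h) (tensor_assoc U V W u) =
    tensor_form (U \<otimes> V) W (tensor_form U V f g) h u"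
proof (rule tensor_map_unique[OF is_vec_ground _ _ _ u])
  note gh = tensor_form_linear[OF vec(2,3) g h] and fg = tensor_form_linear[OF vec(1,2) f g]
  note l = tensor_form_linear[OF vec(1) is_vec_tensor f gh(1)]
    and r = tensor_form_linear[OF is_vec_tensor vec(3) fg(1) h]
  note al = tensor_assoc_linear[OF vec]
  note L = linear_map_comp[OF al(1) l(1)]
  show "linear_map ((U \<otimes> V) \<otimes> W) ground
      (\<lambda>u. tensor_form U (V \<otimes> W) f (tensor_form V W g h) (tensor_assoc U V W u))"
    by (rule L)
  show "linear_map ((U \<otimes> V) \<otimes> W) ground (tensor_form (U \<otimes> V) W (tensor_form U V f g) h)"
    by (rule r)
  \<comment> \<open>A pure tensor of \<open>(U \<otimes> V) \<otimes> W\<close> still has an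
    arbitrary tensor \<open>s\<close> as left factor; linearity in \<open>s\<close> permits a second
    reduction to pure tensors.\<close>
  fix s z assume s: "s \<in> car (U \<otimes> V)" and z: "z \<in> car W"
  note P = linear_map_pure(1)[OF is_vec_tensor vec(3) z]
  show "tensor_form U (V \<otimes> W) f (tensor_form V W g h) (tensor_assoc U V W (pure (U \<otimes> V) W s z)) =
      tensor_form (U \<otimes> V) W (tensor_form U V f g) h (pure (U \<otimes> V) W s z)"
    by (rule tensor_map_unique[OF is_vec_ground linear_map_comp[OF P L]
          linear_map_comp[OF P r(1)] _ s])
      (simp add: al(2) z l(2) r(2) gh(2) fg(2) pure_in_tensor)
qed

text \<open>On pure tensors both sides are the same product of four scalars in different order.
  Getting there takes three rounds of uniqueness: for the outer tensor and for each of its two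
  factors.\<close>

lemma tensor_form_exchange:
  assumes vec: "is_vec V1" "is_vec V2" "is_vec W1" "is_vec W2"
    and f: "linear_map V1 ground f1" "linear_map V2 ground f2"
    and g: "linear_map W1 ground g1" "linear_map W2 ground g2"
    and t: "t \<in> car ((V1 \<otimes> V2) \<otimes> (W1 \<otimes> W2))"
  shows "tensor_form (V1 \<otimes> W1) (V2 \<otimes> W2) (tensor_form V1 W1 f1 g1) (tensor_form V2 W2 f2 g2)
      (tensor_exchange V1 V2 W1 W2 t) =
    tensor_form (V1 \<otimes> V2) (W1 \<otimes> W2) (tensor_form V1 V2 f1 f2) (tensor_form W1 W2 g1 g2) t"
proof (rule tensor_map_unique[OF is_vec_ground _ _ _ t])
  note a = tensor_form_linear[OF vec(1,3) f(1) g(1)] tensor_form_linear[OF vec(2,4) f(2) g(2)]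
    tensor_form_linear[OF vec(1,2) f] tensor_form_linear[OF vec(3,4) g]
  note l = tensor_form_linear[OF is_vec_tensor is_vec_tensor a(1,3)]
    and r = tensor_form_linear[OF is_vec_tensor is_vec_tensor a(5,7)]
  note e = tensor_exchange_linear[OF vec]
  note L = linear_map_comp[OF e(1) l(1)]
  show "linear_map ((V1 \<otimes> V2) \<otimes> (W1 \<otimes> W2)) ground
      (\<lambda>t. tensor_form (V1 \<otimes> W1) (V2 \<otimes> W2) (tensor_form V1 W1 f1 g1) (tensor_form V2 W2 f2 g2)
        (tensor_exchange V1 V2 W1 W2 t))"
    by (rule L)
  show "linear_map ((V1 \<otimes> V2) \<otimes> (W1 \<otimes> W2)) ground
      (tensor_form (V1 \<otimes> V2) (W1 \<otimes> W2) (tensor_form V1 V2 f1 f2) (tensor_form W1 W2 g1 g2))"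
    by (rule r)
  fix s s' assume s: "s \<in> car (V1 \<otimes> V2)" and s': "s' \<in> car (W1 \<otimes> W2)"
  note P = linear_map_pure(1)[OF is_vec_tensor is_vec_tensor s']
  show "tensor_form (V1 \<otimes> W1) (V2 \<otimes> W2) (tensor_form V1 W1 f1 g1) (tensor_form V2 W2 f2 g2)
        (tensor_exchange V1 V2 W1 W2 (pure (V1 \<otimes> V2) (W1 \<otimes> W2) s s')) =
      tensor_form (V1 \<otimes> V2) (W1 \<otimes> W2) (tensor_form V1 V2 f1 f2) (tensor_form W1 W2 g1 g2)
        (pure (V1 \<otimes> V2) (W1 \<otimes> W2) s s')"
  proof (rule tensor_map_unique[OF is_vec_ground linear_map_comp[OF P L]
        linear_map_comp[OF P r(1)] _ s])
    fix x1 x2 assume x: "x1 \<in> car V1" "x2 \<in> car V2"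
    note Q = linear_map_pure(2)[OF is_vec_tensor is_vec_tensor pure_in_tensor[OF x]]
    show "tensor_form (V1 \<otimes> W1) (V2 \<otimes> W2) (tensor_form V1 W1 f1 g1) (tensor_form V2 W2 f2 g2)
        (tensor_exchange V1 V2 W1 W2 (pure (V1 \<otimes> V2) (W1 \<otimes> W2) (pure V1 V2 x1 x2) s')) =
      tensor_form (V1 \<otimes> V2) (W1 \<otimes> W2) (tensor_form V1 V2 f1 f2) (tensor_form W1 W2 g1 g2)
        (pure (V1 \<otimes> V2) (W1 \<otimes> W2) (pure V1 V2 x1 x2) s')"
      by (rule tensor_map_unique[OF is_vec_ground linear_map_comp[OF Q L]
            linear_map_comp[OF Q r(1)] _ s'])
        (simp add: e(2) x l(2) r(2) a(2,4,6,8) pure_in_tensor)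
  qed
qed

section \<open>Convolution of linear forms\<close>

text \<open>One component of the convolution product: the ordered decomposition into
  \<open>A\<close> and \<open>B\<close> is fixed instead of summed over, so that the order of the
  blocks is remembered.\<close>

definition convolution ::
    "('a, 'k::field, 'v::ab_group_add, 'm) bimonoid_species_scheme \<Rightarrow> 'a set \<Rightarrow> 'a set
      \<Rightarrow> ('v \<Rightarrow> 'k) \<Rightarrow> ('v \<Rightarrow> 'k) \<Rightarrow> 'v \<Rightarrow> 'k" where
  "convolution H A B f g x = tensor_form (obj H A) (obj H B) f g (Delta H A B x)"

context comonoid_species
begin

lemma convolution_linear:
  assumes "finite A" "finite B" "A \<inter> B = {}"
    and "linear_map (obj H A) ground f" "linear_map (obj H B) ground g"
  shows "linear_map (obj H (A \<union> B)) ground (convolution H A B f g)"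
  unfolding convolution_def
  by (rule linear_map_comp[OF Delta_linear[OF assms(1-3)]
        tensor_form_linear(1)[OF vec[OF assms(1)] vec[OF assms(2)] assms(4,5)]])

lemma convolution_cong:
  assumes "finite A" "finite B" "A \<inter> B = {}"
    and "linear_map (obj H A) ground f" "linear_map (obj H B) ground g"
    and "\<And>x. x \<in> car (obj H A) \<Longrightarrow> f x = f' x" and "\<And>y. y \<in> car (obj H B) \<Longrightarrow> g y = g' y"
    and "x \<in> car (obj H (A \<union> B))"
  shows "convolution H A B f g x = convolution H A B f' g' x"
  unfolding convolution_def
  by (rule tensor_form_cong[OF vec[OF assms(1)] vec[OF assms(2)] assms(4-7)
        linear_mapD(1)[OF Delta_linear[OF assms(1-3)] assms(8)]])

lemma convolution_assoc:
  assumes fin: "finite A" "finite B" "finite C"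
    and dis: "A \<inter> B = {}" "A \<inter> C = {}" "B \<inter> C = {}"
    and lin: "linear_map (obj H A) ground f" "linear_map (obj H B) ground g"
      "linear_map (obj H C) ground k"
    and x: "x \<in> car (obj H (A \<union> B \<union> C))"
  shows "convolution H (A \<union> B) C (convolution H A B f g) k x =
    convolution H A (B \<union> C) f (convolution H B C g k) x"
proof -
  have v: "is_vec (obj H A)" "is_vec (obj H B)" "is_vec (obj H C)"
    "is_vec (obj H (A \<union> B))" "is_vec (obj H (B \<union> C))"
    using fin by (auto intro: vec)
  have d: "(A \<union> B) \<inter> C = {}" "A \<inter> (B \<union> C) = {}" using dis by auto
  note DAB = Delta_linear[OF fin(1,2) dis(1)] and DBC = Delta_linear[OF fin(2,3) dis(3)]
  note fg = tensor_form_linear(1)[OF v(1,2) lin(1,2)] and gk = tensor_form_linear(1)[OF v(2,3) lin(2,3)]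
  have l: "Delta H (A \<union> B) C x \<in> car (obj H (A \<union> B) \<otimes> obj H C)"
    by (rule linear_mapD(1)[OF Delta_linear x]) (use fin d in auto)
  have r: "Delta H A (B \<union> C) x \<in> car (obj H A \<otimes> obj H (B \<union> C))"
    by (rule linear_mapD(1)[OF Delta_linear]) (use fin d x in \<open>auto simp: Un_assoc\<close>)
  \<comment> \<open>The threefold coproduct in the left bracketing. Both iterated convolutions are
    pairings with it, one directly and the other after reassociation.\<close>
  let ?u = "tensor_map (obj H (A \<union> B)) (obj H C) (obj H A \<otimes> obj H B) (obj H C) (Delta H A B) id
      (Delta H (A \<union> B) C x)"
  have u: "?u \<in> car ((obj H A \<otimes> obj H B) \<otimes> obj H C)"
    by (rule linear_mapD(1)[OF tensor_map_linear(1)[OF v(4,3) is_vec_tensor v(3) DAB linear_map_id(1)] l])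
  have "convolution H (A \<union> B) C (convolution H A B f g) k x =
      tensor_form (obj H A \<otimes> obj H B) (obj H C) (tensor_form (obj H A) (obj H B) f g) k ?u"
    using tensor_form_map[OF v(4,3) is_vec_tensor v(3) DAB linear_map_id(1) fg lin(3) l]
    by (simp add: convolution_def[abs_def])
  also have "\<dots> = tensor_form (obj H A) (obj H B \<otimes> obj H C) f (tensor_form (obj H B) (obj H C) g k)
      (tensor_assoc (obj H A) (obj H B) (obj H C) ?u)"
    by (rule tensor_form_assoc[OF v(1-3) lin u, symmetric])
  also have "\<dots> = tensor_form (obj H A) (obj H B \<otimes> obj H C) f (tensor_form (obj H B) (obj H C) g k)
      (tensor_map (obj H A) (obj H (B \<union> C)) (obj H A) (obj H B \<otimes> obj H C) id (Delta H B C)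
        (Delta H A (B \<union> C) x))"
    by (simp only: Delta_coassoc[OF fin dis x])
  also have "\<dots> = convolution H A (B \<union> C) f (convolution H B C g k) x"
    using tensor_form_map[OF v(1,5,1) is_vec_tensor linear_map_id(1) DBC lin(1) gk r]
    by (simp add: convolution_def[abs_def])
  finally show ?thesis .
qed

lemma convolution_counit_left:
  assumes A: "finite A" and f: "linear_map (obj H A) ground f" and x: "x \<in> car (obj H A)"
  shows "convolution H {} A (eps H) f x = f x"
proof -
  have D: "Delta H {} A x \<in> car (obj H {} \<otimes> obj H A)"
    using linear_mapD(1)[OF Delta_linear[of "{}" A]] A x by simp
  \<comment> \<open>The form \<open>eps H\<close> is read as the identity form of the field pulled
    back along \<open>eps H\<close>, so that the counit axiom applies.\<close>
  have "convolution H {} A (eps H) f x = tensor_form ground (obj H A) id f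
      (tensor_map (obj H {}) (obj H A) ground (obj H A) (eps H) id (Delta H {} A x))"
    using tensor_form_map[OF vec vec[OF A] is_vec_ground vec[OF A] eps_linear linear_map_id(1)
        linear_map_id(1) f D]
    by (simp add: convolution_def)
  also have "\<dots> = f x"
    using tensor_form_linear(2)[OF is_vec_ground vec[OF A] linear_map_id(1) f, of 1 x] x
    by (simp add: Delta_counit_left[OF A x])
  finally show ?thesis .
qed

lemma convolution_counit_right:
  assumes A: "finite A" and f: "linear_map (obj H A) ground f" and x: "x \<in> car (obj H A)"
  shows "convolution H A {} f (eps H) x = f x"
proof -
  have D: "Delta H A {} x \<in> car (obj H A \<otimes> obj H {})"
    using linear_mapD(1)[OF Delta_linear[of A "{}"]] A x by simp
  have "convolution H A {} f (eps H) x = tensor_form (obj H A) ground f id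
      (tensor_map (obj H A) (obj H {}) (obj H A) ground id (eps H) (Delta H A {} x))"
    using tensor_form_map[OF vec[OF A] vec vec[OF A] is_vec_ground linear_map_id(1) eps_linear f
        linear_map_id(1) D]
    by (simp add: convolution_def)
  also have "\<dots> = f x"
    using tensor_form_linear(2)[OF vec[OF A] is_vec_ground f linear_map_id(1), of x 1] x
    by (simp add: Delta_counit_right[OF A x])
  finally show ?thesis .
qed

text \<open>Naturality of the coproduct, paired with two forms, moves a relabelling from the vector
  into the forms.\<close>

lemma convolution_act:
  assumes fin: "finite A" "finite B" and dis: "A \<inter> B = {}" and inj: "inj_on \<sigma> (A \<union> B)"
    and lin: "linear_map (obj H (\<sigma> ` A)) ground f" "linear_map (obj H (\<sigma> ` B)) ground g"
    and x: "x \<in> car (obj H (A \<union> B))"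
  shows "convolution H (\<sigma> ` A) (\<sigma> ` B) f g (act H \<sigma> (A \<union> B) x) =
    convolution H A B (\<lambda>y. f (act H \<sigma> A y)) (\<lambda>z. g (act H \<sigma> B z)) x"
proof -
  have i: "inj_on \<sigma> A" "inj_on \<sigma> B" using inj by (auto simp: inj_on_Un)
  have D: "Delta H A B x \<in> car (obj H A \<otimes> obj H B)"
    by (rule linear_mapD(1)[OF Delta_linear[OF fin dis] x])
  show ?thesis
    unfolding convolution_def Delta_natural[OF fin dis inj x]
    using fin by (intro tensor_form_map vec act_linear i lin D finite_imageI)
qed

end

text \<open>Pulling forms back along a comonoid morphism respects convolution; uniqueness rests on
  this. The target is only asked to consist of vector spaces, so \<open>WQSym\<close> can be
  inserted directly from its defining formulas.\<close>

lemma comonoid_morphism_convolution: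
  assumes "comonoid_species G" and vec: "\<And>I. finite I \<Longrightarrow> is_vec (obj H I)"
    and \<alpha>: "comonoid_morphism G H \<alpha>"
    and fin: "finite A" "finite B" and dis: "A \<inter> B = {}"
    and lin: "linear_map (obj H A) ground f" "linear_map (obj H B) ground g"
    and x: "x \<in> car (obj G (A \<union> B))"
  shows "convolution H A B f g (\<alpha> (A \<union> B) x) = convolution G A B (\<lambda>y. f (\<alpha> A y)) (\<lambda>z. g (\<alpha> B z)) x"
proof -
  interpret G: comonoid_species G by fact
  have D: "Delta G A B x \<in> car (obj G A \<otimes> obj G B)"
    by (rule linear_mapD(1)[OF G.Delta_linear[OF fin dis] x])
  have "linear_map (obj G I) (obj H I) (\<alpha> I)" if "finite I" for I
    using \<alpha> that unfolding comonoid_morphism_def species_morphism_def by blast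
  note l = this[OF fin(1)] this[OF fin(2)]
  have "Delta H A B (\<alpha> (A \<union> B) x) =
      tensor_map (obj G A) (obj G B) (obj H A) (obj H B) (\<alpha> A) (\<alpha> B) (Delta G A B x)"
    using \<alpha> fin dis x unfolding comonoid_morphism_def by blast
  then show ?thesis
    unfolding convolution_def
    using tensor_form_map[OF G.vec[OF fin(1)] G.vec[OF fin(2)] vec[OF fin(1)] vec[OF fin(2)] l lin D]
    by simp
qed

text \<open>The bimonoid axiom paired with forms. The factors \<open>f1\<close>, \<open>f2\<close>,
  \<open>g1\<close>, \<open>g2\<close> are separate parameters because an iterated form factors into
  forms of other lists, those of the blocks cut down to \<open>A\<close> and to
  \<open>B\<close>.\<close>

lemma (in bimonoid_species) convolution_mu:
  assumes fin: "finite A" "finite B" and dis: "A \<inter> B = {}" "C \<inter> D = {}" and un: "A \<union> B = C \<union> D"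
    and f: "linear_map (obj H C) ground f" and g: "linear_map (obj H D) ground g"
    and f1: "linear_map (obj H (A \<inter> C)) ground f1" and f2: "linear_map (obj H (B \<inter> C)) ground f2"
    and g1: "linear_map (obj H (A \<inter> D)) ground g1" and g2: "linear_map (obj H (B \<inter> D)) ground g2"
    and f_mu: "\<And>y z. y \<in> car (obj H (A \<inter> C)) \<Longrightarrow> z \<in> car (obj H (B \<inter> C)) \<Longrightarrow>
      f (mu H (A \<inter> C) (B \<inter> C) (pure (obj H (A \<inter> C)) (obj H (B \<inter> C)) y z)) = f1 y * f2 z"
    and g_mu: "\<And>y z. y \<in> car (obj H (A \<inter> D)) \<Longrightarrow> z \<in> car (obj H (B \<inter> D)) \<Longrightarrow>
      g (mu H (A \<inter> D) (B \<inter> D) (pure (obj H (A \<inter> D)) (obj H (B \<inter> D)) y z)) = g1 y * g2 z"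
    and x: "x \<in> car (obj H A)" and y: "y \<in> car (obj H B)"
  shows "convolution H C D f g (mu H A B (pure (obj H A) (obj H B) x y)) =
    convolution H (A \<inter> C) (A \<inter> D) f1 g1 x * convolution H (B \<inter> C) (B \<inter> D) f2 g2 y"
proof -
  have finCD: "finite C" "finite D" using fin un by (metis finite_Un)+
  have eq: "(A \<inter> C) \<union> (B \<inter> C) = C" "(A \<inter> D) \<union> (B \<inter> D) = D"
    "(A \<inter> C) \<union> (A \<inter> D) = A" "(B \<inter> C) \<union> (B \<inter> D) = B"
    using un by auto
  have v: "is_vec (obj H A)" "is_vec (obj H B)" "is_vec (obj H C)" "is_vec (obj H D)"
    "is_vec (obj H (A \<inter> C))" "is_vec (obj H (A \<inter> D))" "is_vec (obj H (B \<inter> C))" "is_vec (obj H (B \<inter> D))"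
    using fin finCD by (auto intro: vec)
  have muC: "linear_map (obj H (A \<inter> C) \<otimes> obj H (B \<inter> C)) (obj H C) (mu H (A \<inter> C) (B \<inter> C))"
    using mu_linear[of "A \<inter> C" "B \<inter> C"] fin dis eq(1) by auto
  have muD: "linear_map (obj H (A \<inter> D) \<otimes> obj H (B \<inter> D)) (obj H D) (mu H (A \<inter> D) (B \<inter> D))"
    using mu_linear[of "A \<inter> D" "B \<inter> D"] fin dis eq(2) by auto
  have DA: "linear_map (obj H A) (obj H (A \<inter> C) \<otimes> obj H (A \<inter> D)) (Delta H (A \<inter> C) (A \<inter> D))"
    using Delta_linear[of "A \<inter> C" "A \<inter> D"] fin dis eq(3) by auto
  have DB: "linear_map (obj H B) (obj H (B \<inter> C) \<otimes> obj H (B \<inter> D)) (Delta H (B \<inter> C) (B \<inter> D))"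
    using Delta_linear[of "B \<inter> C" "B \<inter> D"] fin dis eq(4) by auto
  note t = pure_in_tensor[OF x y]
  note M = tensor_map_linear[OF v(1,2) is_vec_tensor is_vec_tensor DA DB]
  let ?s = "tensor_map (obj H A) (obj H B) (obj H (A \<inter> C) \<otimes> obj H (A \<inter> D))
      (obj H (B \<inter> C) \<otimes> obj H (B \<inter> D)) (Delta H (A \<inter> C) (A \<inter> D)) (Delta H (B \<inter> C) (B \<inter> D))
      (pure (obj H A) (obj H B) x y)"
  let ?e = "tensor_exchange (obj H (A \<inter> C)) (obj H (A \<inter> D)) (obj H (B \<inter> C)) (obj H (B \<inter> D)) ?s"
  have s: "?s \<in> car ((obj H (A \<inter> C) \<otimes> obj H (A \<inter> D)) \<otimes> (obj H (B \<inter> C) \<otimes> obj H (B \<inter> D)))"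
    by (rule linear_mapD(1)[OF M(1) t])
  have e: "?e \<in> car ((obj H (A \<inter> C) \<otimes> obj H (B \<inter> C)) \<otimes> (obj H (A \<inter> D) \<otimes> obj H (B \<inter> D)))"
    by (rule linear_mapD(1)[OF tensor_exchange_linear(1)[OF v(5,6,7,8)] s])
  note F = tensor_form_linear[OF v(5,7) f1 f2] and G = tensor_form_linear[OF v(6,8) g1 g2]
  note Fm = linear_map_comp[OF muC f] and Gm = linear_map_comp[OF muD g]
  note K1 = tensor_form_linear(1)[OF v(5,6) f1 g1] and K2 = tensor_form_linear(1)[OF v(7,8) f2 g2]
  have "convolution H C D f g (mu H A B (pure (obj H A) (obj H B) x y)) =
      tensor_form (obj H C) (obj H D) f g
        (tensor_map (obj H (A \<inter> C) \<otimes> obj H (B \<inter> C)) (obj H (A \<inter> D) \<otimes> obj H (B \<inter> D)) (obj H C) (obj H D)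
          (mu H (A \<inter> C) (B \<inter> C)) (mu H (A \<inter> D) (B \<inter> D)) ?e)"
    unfolding convolution_def by (simp only: Delta_mu[OF fin dis un t])
  also have "\<dots> = tensor_form (obj H (A \<inter> C) \<otimes> obj H (B \<inter> C)) (obj H (A \<inter> D) \<otimes> obj H (B \<inter> D))
      (\<lambda>t. f (mu H (A \<inter> C) (B \<inter> C) t)) (\<lambda>t. g (mu H (A \<inter> D) (B \<inter> D) t)) ?e"
    by (rule tensor_form_map[OF is_vec_tensor is_vec_tensor v(3,4) muC muD f g e])
  also have "\<dots> = tensor_form (obj H (A \<inter> C) \<otimes> obj H (B \<inter> C)) (obj H (A \<inter> D) \<otimes> obj H (B \<inter> D))
      (tensor_form (obj H (A \<inter> C)) (obj H (B \<inter> C)) f1 f2)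
      (tensor_form (obj H (A \<inter> D)) (obj H (B \<inter> D)) g1 g2) ?e"
  \<comment> \<open>Multiplicativity is assumed on pure tensors only and extends to all tensors by
    uniqueness of linear maps.\<close>
  proof (rule tensor_form_cong[OF is_vec_tensor is_vec_tensor Fm Gm _ _ e])
    show "f (mu H (A \<inter> C) (B \<inter> C) t) = tensor_form (obj H (A \<inter> C)) (obj H (B \<inter> C)) f1 f2 t"
      if "t \<in> car (obj H (A \<inter> C) \<otimes> obj H (B \<inter> C))" for t
      by (rule tensor_map_unique[OF is_vec_ground Fm F(1) _ that]) (simp add: F(2) f_mu)
    show "g (mu H (A \<inter> D) (B \<inter> D) t) = tensor_form (obj H (A \<inter> D)) (obj H (B \<inter> D)) g1 g2 t"
      if "t \<in> car (obj H (A \<inter> D) \<otimes> obj H (B \<inter> D))" for t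
      by (rule tensor_map_unique[OF is_vec_ground Gm G(1) _ that]) (simp add: G(2) g_mu)
  qed
  \<comment> \<open>The grouping of the four forms by \<open>C\<close> and \<open>D\<close> becomes
    the grouping by \<open>A\<close> and \<open>B\<close>, which fits the pure tensor of
    \<open>x\<close> and \<open>y\<close>.\<close>
  also have "\<dots> = tensor_form (obj H (A \<inter> C) \<otimes> obj H (A \<inter> D)) (obj H (B \<inter> C) \<otimes> obj H (B \<inter> D))
      (tensor_form (obj H (A \<inter> C)) (obj H (A \<inter> D)) f1 g1)
      (tensor_form (obj H (B \<inter> C)) (obj H (B \<inter> D)) f2 g2) ?s"
    by (rule tensor_form_exchange[OF v(5,6,7,8) f1 g1 f2 g2 s])
  also have "\<dots> = convolution H (A \<inter> C) (A \<inter> D) f1 g1 x * convolution H (B \<inter> C) (B \<inter> D) f2 g2 y"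
    unfolding convolution_def M(2)[OF x y]
    by (rule tensor_form_linear(2)[OF is_vec_tensor is_vec_tensor K1 K2
          linear_mapD(1)[OF DA x] linear_mapD(1)[OF DB y]])
  finally show ?thesis .
qed

section \<open>Iterated convolutions of a character\<close>

primrec iterated_form ::
    "('a, 'k::field, 'v::ab_group_add, 'm) bimonoid_species_scheme \<Rightarrow> ('a set \<Rightarrow> 'v \<Rightarrow> 'k)
      \<Rightarrow> 'a set list \<Rightarrow> 'v \<Rightarrow> 'k" where
  "iterated_form H \<eta> [] = \<eta> {}"
| "iterated_form H \<eta> (S # \<pi>) = convolution H S (\<Union>(set \<pi>)) (\<eta> S) (iterated_form H \<eta> \<pi>)"

locale combinatorial_bimonoid = bimonoid_species H
  for H :: "('a, 'k::field, 'v::ab_group_add, 'm) bimonoid_species_scheme" +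
  fixes \<eta> :: "'a set \<Rightarrow> 'v \<Rightarrow> 'k"
  assumes char: "character H \<eta>"
begin

lemma eta_linear: "finite I \<Longrightarrow> linear_map (obj H I) ground (\<eta> I)"
  using char unfolding character_def monoid_morphism_def species_morphism_def exp_species_def by auto

lemma eta_act: "finite I \<Longrightarrow> inj_on \<sigma> I \<Longrightarrow> x \<in> car (obj H I) \<Longrightarrow> \<eta> (\<sigma> ` I) (act H \<sigma> I x) = \<eta> I x"
  using char unfolding character_def monoid_morphism_def species_morphism_def exp_species_def by auto

lemma eta_eps: "x \<in> car (obj H {}) \<Longrightarrow> \<eta> {} x = eps H x"
  using char unfolding character_def by auto

lemma eta_iota: "\<eta> {} (iota H c) = c"
  using char unfolding character_def monoid_morphism_def exp_species_def by auto

lemma eta_mu: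
  assumes "finite A" "finite B" "A \<inter> B = {}" "x \<in> car (obj H A)" "y \<in> car (obj H B)"
  shows "\<eta> (A \<union> B) (mu H A B (pure (obj H A) (obj H B) x y)) = \<eta> A x * \<eta> B y"
proof -
  have "\<eta> (A \<union> B) (mu H A B (pure (obj H A) (obj H B) x y)) =
      tensor_lift ground ground ground (*) (tensor_map (obj H A) (obj H B) ground ground (\<eta> A) (\<eta> B)
        (pure (obj H A) (obj H B) x y))"
    using char assms pure_in_tensor[OF assms(4,5)]
    unfolding character_def monoid_morphism_def exp_species_def by simp
  also have "\<dots> = \<eta> A x * \<eta> B y"
    using tensor_map_linear(2)[OF vec[OF assms(1)] vec[OF assms(2)] is_vec_ground is_vec_ground
        eta_linear[OF assms(1)] eta_linear[OF assms(2)] assms(4,5)]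
      tensor_form_linear(2)[OF is_vec_ground is_vec_ground linear_map_id(2) linear_map_id(2),
        of "\<eta> A x" "\<eta> B y"]
    by (simp add: tensor_form_def)
  finally show ?thesis .
qed

lemma iterated_form_linear:
  assumes "sorted_wrt disjnt \<pi>" and "finite (\<Union>(set \<pi>))"
  shows "linear_map (obj H (\<Union>(set \<pi>))) ground (iterated_form H \<eta> \<pi>)"
  using assms
proof (induction \<pi>)
  case Nil
  then show ?case by (simp add: eta_linear)
next
  case (Cons S \<pi>)
  then have "S \<inter> \<Union>(set \<pi>) = {}" by (auto simp: disjnt_def)
  then show ?case
    using Cons by (auto intro: convolution_linear eta_linear)
qed

text \<open>On \<open>obj H {}\<close> the form \<open>\<eta> {}\<close> is the counit, hence a left
  unit for convolution. This is what allows an empty leading block to be dropped.\<close>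

lemma iterated_form_counit:
  assumes "sorted_wrt disjnt \<pi>" and "finite (\<Union>(set \<pi>))" and "x \<in> car (obj H (\<Union>(set \<pi>)))"
  shows "convolution H {} (\<Union>(set \<pi>)) (\<eta> {}) (iterated_form H \<eta> \<pi>) x = iterated_form H \<eta> \<pi> x"
proof -
  note l = iterated_form_linear[OF assms(1,2)]
  have "convolution H {} (\<Union>(set \<pi>)) (\<eta> {}) (iterated_form H \<eta> \<pi>) x =
      convolution H {} (\<Union>(set \<pi>)) (eps H) (iterated_form H \<eta> \<pi>) x"
    by (rule convolution_cong) (use assms in \<open>auto simp: eta_eps intro: l eta_linear\<close>)
  also have "\<dots> = iterated_form H \<eta> \<pi> x"
    by (rule convolution_counit_left[OF assms(2) l assms(3)])
  finally show ?thesis .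
qed

text \<open>The empty tail contributes \<open>\<eta> {}\<close>, which is the counit and hence a
  right unit.\<close>

lemma iterated_form_singleton:
  assumes "finite S" and "x \<in> car (obj H S)"
  shows "iterated_form H \<eta> [S] x = \<eta> S x"
proof -
  have "convolution H S {} (\<eta> S) (\<eta> {}) x = convolution H S {} (\<eta> S) (eps H) x"
    by (rule convolution_cong) (use assms in \<open>auto simp: eta_eps intro: eta_linear\<close>)
  also have "\<dots> = \<eta> S x"
    by (rule convolution_counit_right[OF assms(1) eta_linear[OF assms(1)] assms(2)])
  finally show ?thesis by simp
qed

text \<open>Induction on \<open>\<pi>\<close>: the empty list contributes a left unit, and each
  further block is moved across by associativity.\<close>

lemma iterated_form_append:
  assumes "sorted_wrt disjnt (\<pi> @ \<tau>)" and "finite (\<Union>(set (\<pi> @ \<tau>)))"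
    and "x \<in> car (obj H (\<Union>(set (\<pi> @ \<tau>))))"
  shows "iterated_form H \<eta> (\<pi> @ \<tau>) x =
    convolution H (\<Union>(set \<pi>)) (\<Union>(set \<tau>)) (iterated_form H \<eta> \<pi>) (iterated_form H \<eta> \<tau>) x"
  using assms
proof (induction \<pi> arbitrary: x)
  case Nil
  then show ?case using iterated_form_counit by simp
next
  case (Cons S \<pi>)
  let ?P = "\<Union>(set \<pi>)" and ?T = "\<Union>(set \<tau>)"
  have fin: "finite S" "finite ?P" "finite ?T" using Cons.prems(2) by auto
  have dis: "S \<inter> ?P = {}" "S \<inter> ?T = {}" "?P \<inter> ?T = {}"
    using Cons.prems(1) by (fastforce simp: sorted_wrt_append disjnt_iff)+
  have so: "sorted_wrt disjnt (\<pi> @ \<tau>)" "sorted_wrt disjnt \<pi>" "sorted_wrt disjnt \<tau>"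
    using Cons.prems(1) by (auto simp: sorted_wrt_append)
  have un: "\<Union>(set (\<pi> @ \<tau>)) = ?P \<union> ?T" by auto
  note l = eta_linear[OF fin(1)] iterated_form_linear[OF so(2) fin(2)] iterated_form_linear[OF so(3) fin(3)]
  have lPT: "linear_map (obj H (?P \<union> ?T)) ground (iterated_form H \<eta> (\<pi> @ \<tau>))"
    using iterated_form_linear[OF so(1)] fin unfolding un by auto
  have x: "x \<in> car (obj H (S \<union> ?P \<union> ?T))"
    using Cons.prems(3) by (simp add: Un_assoc)
  have "iterated_form H \<eta> ((S # \<pi>) @ \<tau>) x =
      convolution H S (?P \<union> ?T) (\<eta> S) (iterated_form H \<eta> (\<pi> @ \<tau>)) x"
    by simp
  also have "\<dots> = convolution H S (?P \<union> ?T) (\<eta> S)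
      (convolution H ?P ?T (iterated_form H \<eta> \<pi>) (iterated_form H \<eta> \<tau>)) x"
  proof (rule convolution_cong[OF _ _ _ l(1) lPT])
    show "iterated_form H \<eta> (\<pi> @ \<tau>) y =
        convolution H ?P ?T (iterated_form H \<eta> \<pi>) (iterated_form H \<eta> \<tau>) y"
      if "y \<in> car (obj H (?P \<union> ?T))" for y
      using Cons.IH[OF so(1)] fin that by simp
  qed (use fin dis x in \<open>auto simp: Un_assoc\<close>)
  also have "\<dots> = convolution H (S \<union> ?P) ?T (convolution H S ?P (\<eta> S) (iterated_form H \<eta> \<pi>))
      (iterated_form H \<eta> \<tau>) x"
    by (rule convolution_assoc[OF fin dis l x, symmetric])
  finally show ?case by simp
qed

text \<open>An empty leading block contributes a left unit and disappears. A non-empty one is kept,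
  and the induction hypothesis enters through congruence in the second form.\<close>

lemma iterated_form_filter:
  assumes "sorted_wrt disjnt \<pi>" and "finite (\<Union>(set \<pi>))" and "x \<in> car (obj H (\<Union>(set \<pi>)))"
  shows "iterated_form H \<eta> (filter (\<lambda>S. S \<noteq> {}) \<pi>) x = iterated_form H \<eta> \<pi> x"
  using assms
proof (induction \<pi> arbitrary: x)
  case (Cons S \<pi>)
  let ?\<tau> = "filter (\<lambda>S. S \<noteq> {}) \<pi>"
  have so: "sorted_wrt disjnt \<pi>" and fin: "finite S" "finite (\<Union>(set \<pi>))"
    and dis: "S \<inter> \<Union>(set \<pi>) = {}"
    using Cons.prems by (auto simp: disjnt_def[of S])
  have un: "\<Union>(set ?\<tau>) = \<Union>(set \<pi>)" by auto
  note l = iterated_form_linear[OF so fin(2)]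
  show ?case
  proof (cases "S = {}")
    case True
    then show ?thesis
      using iterated_form_counit[OF so fin(2)] Cons.IH[OF so fin(2)] Cons.prems(3) by simp
  next
    case False
    have "iterated_form H \<eta> (filter (\<lambda>S. S \<noteq> {}) (S # \<pi>)) x =
        convolution H S (\<Union>(set \<pi>)) (\<eta> S) (iterated_form H \<eta> ?\<tau>) x"
      using False by (simp only: filter.simps iterated_form.simps un if_True not_False_eq_True)
    also have "\<dots> = convolution H S (\<Union>(set \<pi>)) (\<eta> S) (iterated_form H \<eta> \<pi>) x"
      by (rule convolution_cong[symmetric])
        (use fin dis l Cons.IH[OF so fin(2)] Cons.prems(3) in \<open>auto intro: eta_linear\<close>)
    finally show ?thesis by simp
  qed
qed simp

text \<open>Naturality of the coproduct distributes the relabelling over the blocks, where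
  invariance of \<open>\<eta>\<close> absorbs it.\<close>

lemma iterated_form_act:
  assumes "sorted_wrt disjnt \<pi>" and "finite (\<Union>(set \<pi>))" and "inj_on \<sigma> (\<Union>(set \<pi>))"
    and "x \<in> car (obj H (\<Union>(set \<pi>)))"
  shows "iterated_form H \<eta> (map ((`) \<sigma>) \<pi>) (act H \<sigma> (\<Union>(set \<pi>)) x) = iterated_form H \<eta> \<pi> x"
  using assms
proof (induction \<pi> arbitrary: x)
  case Nil
  then show ?case using eta_act[of "{}" \<sigma> x] by simp
next
  case (Cons S \<pi>)
  let ?P = "\<Union>(set \<pi>)"
  have so: "sorted_wrt disjnt \<pi>" and fin: "finite S" "finite ?P" and dis: "S \<inter> ?P = {}"
    using Cons.prems by (auto simp: disjnt_def[of S])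
  have inj: "inj_on \<sigma> (S \<union> ?P)" "inj_on \<sigma> S" "inj_on \<sigma> ?P"
    using Cons.prems(3) by (auto simp: inj_on_Un)
  have un: "\<Union>(set (map ((`) \<sigma>) \<pi>)) = \<sigma> ` ?P" by auto
  \<comment> \<open>Injectivity keeps the images of the blocks disjoint, so the relabelled list
    still gives a linear form.\<close>
  have so': "sorted_wrt disjnt (map ((`) \<sigma>) \<pi>)"
  proof -
    have "disjnt (\<sigma> ` T) (\<sigma> ` T')" if "T \<in> set \<pi>" "T' \<in> set \<pi>" "disjnt T T'" for T T'
      using inj_on_image_Int[OF inj(3), of T T'] that by (auto simp: disjnt_def)
    then show ?thesis
      using sorted_wrt_mono_rel[OF _ so] by (simp add: sorted_wrt_map)
  qed
  have l: "linear_map (obj H (\<sigma> ` ?P)) ground (iterated_form H \<eta> (map ((`) \<sigma>) \<pi>))"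
    using iterated_form_linear[OF so'] fin(2) unfolding un by simp
  have x: "x \<in> car (obj H (S \<union> ?P))" using Cons.prems(4) by simp
  have "iterated_form H \<eta> (map ((`) \<sigma>) (S # \<pi>)) (act H \<sigma> (\<Union>(set (S # \<pi>))) x) =
      convolution H (\<sigma> ` S) (\<sigma> ` ?P) (\<eta> (\<sigma> ` S)) (iterated_form H \<eta> (map ((`) \<sigma>) \<pi>))
        (act H \<sigma> (S \<union> ?P) x)"
    by (simp only: list.simps iterated_form.simps un) simp
  also have "\<dots> = convolution H S ?P (\<lambda>y. \<eta> (\<sigma> ` S) (act H \<sigma> S y))
      (\<lambda>z. iterated_form H \<eta> (map ((`) \<sigma>) \<pi>) (act H \<sigma> ?P z)) x"
    by (rule convolution_act[OF fin dis inj(1) eta_linear l x]) (simp add: fin)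
  also have "\<dots> = convolution H S ?P (\<eta> S) (iterated_form H \<eta> \<pi>) x"
  proof (rule convolution_cong[OF fin dis])
    show "linear_map (obj H S) ground (\<lambda>y. \<eta> (\<sigma> ` S) (act H \<sigma> S y))"
      by (rule linear_map_comp[OF act_linear eta_linear]) (use fin inj in auto)
    show "linear_map (obj H ?P) ground (\<lambda>z. iterated_form H \<eta> (map ((`) \<sigma>) \<pi>) (act H \<sigma> ?P z))"
      by (rule linear_map_comp[OF act_linear l]) (use fin inj in auto)
  qed (use x fin inj Cons.IH[OF so fin(2) inj(3)] in \<open>auto simp: eta_act\<close>)
  finally show ?case by simp
qed

text \<open>Induction over the blocks with \<open>convolution_mu\<close>. Empty intersections are
  deliberately kept, so that the lists for \<open>A\<close> and \<open>B\<close> lose their first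
  entries in step with \<open>\<pi>\<close>.\<close>

lemma iterated_form_mu:
  assumes "sorted_wrt disjnt \<pi>" and "\<Union>(set \<pi>) = A \<union> B" and "finite A" "finite B" "A \<inter> B = {}"
    and "x \<in> car (obj H A)" and "y \<in> car (obj H B)"
  shows "iterated_form H \<eta> \<pi> (mu H A B (pure (obj H A) (obj H B) x y)) =
    iterated_form H \<eta> (map (\<lambda>S. S \<inter> A) \<pi>) x * iterated_form H \<eta> (map (\<lambda>S. S \<inter> B) \<pi>) y"
  using assms
proof (induction \<pi> arbitrary: A B x y)
  case Nil
  then show ?case using eta_mu[of "{}" "{}" x y] by simp
next
  case (Cons S \<pi>)
  let ?P = "\<Union>(set \<pi>)"
  have so: "sorted_wrt disjnt \<pi>" and dis: "S \<inter> ?P = {}" and un: "A \<union> B = S \<union> ?P"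
    using Cons.prems by (auto simp: disjnt_def[of S])
  have fin: "finite S" "finite ?P"
    using Cons.prems(3,4) un by (metis finite_Un)+
  have fin': "finite (A \<inter> S)" "finite (B \<inter> S)" "finite (A \<inter> ?P)" "finite (B \<inter> ?P)"
    using Cons.prems by auto
  have restrict: "\<Union>(set (map (\<lambda>S. S \<inter> X) \<pi>)) = X \<inter> ?P" for X by auto
  \<comment> \<open>The induction hypothesis is applied to \<open>A \<inter> ?P\<close> and
    \<open>B \<inter> ?P\<close>; all remaining blocks lie in \<open>?P\<close>, so this further
    intersection changes nothing.\<close>
  have cut: "map (\<lambda>S. S \<inter> (X \<inter> ?P)) \<pi> = map (\<lambda>S. S \<inter> X) \<pi>" for X by auto
  have l: "linear_map (obj H (X \<inter> ?P)) ground (iterated_form H \<eta> (map (\<lambda>S. S \<inter> X) \<pi>))" for X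
  proof -
    have "sorted_wrt disjnt (map (\<lambda>S. S \<inter> X) \<pi>)"
      unfolding sorted_wrt_map by (rule sorted_wrt_mono_rel[OF _ so]) (auto simp: disjnt_def)
    from iterated_form_linear[OF this] show ?thesis
      unfolding restrict using fin by auto
  qed
  have "iterated_form H \<eta> (S # \<pi>) (mu H A B (pure (obj H A) (obj H B) x y)) =
      convolution H S ?P (\<eta> S) (iterated_form H \<eta> \<pi>) (mu H A B (pure (obj H A) (obj H B) x y))"
    by simp
  also have "\<dots> =
      convolution H (A \<inter> S) (A \<inter> ?P) (\<eta> (A \<inter> S)) (iterated_form H \<eta> (map (\<lambda>S. S \<inter> A) \<pi>)) x *
      convolution H (B \<inter> S) (B \<inter> ?P) (\<eta> (B \<inter> S)) (iterated_form H \<eta> (map (\<lambda>S. S \<inter> B) \<pi>)) y"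
  proof (rule convolution_mu[OF Cons.prems(3,4,5) dis un eta_linear[OF fin(1)]
        iterated_form_linear[OF so fin(2)] eta_linear[OF fin'(1)] eta_linear[OF fin'(2)] l l
        _ _ Cons.prems(6,7)])
    have S: "(A \<inter> S) \<union> (B \<inter> S) = S" using un by auto
    show "\<eta> S (mu H (A \<inter> S) (B \<inter> S) (pure (obj H (A \<inter> S)) (obj H (B \<inter> S)) y z)) =
        \<eta> (A \<inter> S) y * \<eta> (B \<inter> S) z"
      if "y \<in> car (obj H (A \<inter> S))" "z \<in> car (obj H (B \<inter> S))" for y z
      using eta_mu[OF fin'(1,2) _ that] Cons.prems(5) unfolding S by auto
    show "iterated_form H \<eta> \<pi>
          (mu H (A \<inter> ?P) (B \<inter> ?P) (pure (obj H (A \<inter> ?P)) (obj H (B \<inter> ?P)) y z)) =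
        iterated_form H \<eta> (map (\<lambda>S. S \<inter> A) \<pi>) y * iterated_form H \<eta> (map (\<lambda>S. S \<inter> B) \<pi>) z"
      if "y \<in> car (obj H (A \<inter> ?P))" "z \<in> car (obj H (B \<inter> ?P))" for y z
    proof -
      have P: "?P = (A \<inter> ?P) \<union> (B \<inter> ?P)" using un by auto
      have "(A \<inter> ?P) \<inter> (B \<inter> ?P) = {}" using Cons.prems(5) by auto
      from Cons.IH[OF so P fin'(3,4) this that] show ?thesis unfolding cut .
    qed
  qed
  finally show ?case
    by (simp only: list.simps iterated_form.simps restrict Int_commute[of _ S])
qed

end

section \<open>Set compositions\<close>

lemma set_compositionsD:
  assumes "\<pi> \<in> set_compositions I"
  shows "{} \<notin> set \<pi>" "sorted_wrt disjnt \<pi>" "\<Union>(set \<pi>) = I"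
  using assms by (auto simp: set_compositions_def)

lemma set_compositions_empty: "set_compositions {} = {[]}"
proof -
  have "\<pi> = []" if "\<pi> \<in> set_compositions {}" for \<pi> :: "'a set list"
    using that by (cases \<pi>) (auto simp: set_compositions_def)
  then show ?thesis by (auto simp: set_compositions_def)
qed

lemma set_compositions_ConsD:
  assumes "S # \<rho> \<in> set_compositions I"
  shows "S \<noteq> {}" "S \<union> \<Union>(set \<rho>) = I" "S \<inter> \<Union>(set \<rho>) = {}" "\<rho> \<in> set_compositions (\<Union>(set \<rho>))"
  using assms by (auto simp: set_compositions_def disjnt_def[of S])

lemma singleton_set_composition: "S \<noteq> {} \<Longrightarrow> [S] \<in> set_compositions S"
  by (auto simp: set_compositions_def)

lemma set_compositions_length_le_1:
  assumes "S \<noteq> {}" and "\<pi> \<in> set_compositions S" and "length \<pi> \<le> 1"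
  shows "\<pi> = [S]"
  using assms by (cases \<pi>) (auto simp: set_compositions_def)

lemma restrict_set_composition:
  assumes "\<gamma> \<in> set_compositions I" and "A \<subseteq> I"
  shows "restrict_comp \<gamma> A \<in> set_compositions A"
proof -
  have "sorted_wrt (\<lambda>S T. disjnt (S \<inter> A) (T \<inter> A)) \<gamma>"
    by (rule sorted_wrt_mono_rel[OF _ set_compositionsD(2)[OF assms(1)]]) (auto simp: disjnt_def)
  moreover have "\<Union>(set (restrict_comp \<gamma> A)) = A"
    using set_compositionsD(3)[OF assms(1)] assms(2) by (auto simp: restrict_comp_def) blast
  ultimately show ?thesis
    by (auto simp: set_compositions_def restrict_comp_def sorted_wrt_map intro!: sorted_wrt_filter)
qed

lemma append_set_composition:
  assumes "\<pi> \<in> set_compositions A" and "\<tau> \<in> set_compositions B" and "A \<inter> B = {}"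
  shows "\<pi> @ \<tau> \<in> set_compositions (A \<union> B)"
  using assms by (fastforce simp: set_compositions_def sorted_wrt_append disjnt_iff)

lemma restrict_comp_append: "restrict_comp (\<pi> @ \<tau>) A = restrict_comp \<pi> A @ restrict_comp \<tau> A"
  by (simp add: restrict_comp_def)

lemma restrict_comp_superset:
  assumes "\<pi> \<in> set_compositions A" and "A \<subseteq> B"
  shows "restrict_comp \<pi> B = \<pi>"
proof -
  have "map (\<lambda>S. S \<inter> B) \<pi> = map id \<pi>"
    using set_compositionsD(3)[OF assms(1)] assms(2) by (intro map_cong) auto
  then show ?thesis
    using set_compositionsD(1)[OF assms(1)] by (auto simp: restrict_comp_def filter_id_conv)
qed

lemma restrict_comp_disjoint:
  assumes "\<pi> \<in> set_compositions A" and "A \<inter> B = {}"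
  shows "restrict_comp \<pi> B = []"
  using set_compositionsD(3)[OF assms(1)] assms(2)
  by (auto simp: restrict_comp_def filter_empty_conv)

section \<open>Deconcatenation of set compositions\<close>

text \<open>The condition for a non-zero coproduct in WQSym. The case \<open>p = q\<close> is
  included and forbids a block that meets both sets.\<close>

definition separated :: "'a set list \<Rightarrow> 'a set \<Rightarrow> 'a set \<Rightarrow> bool" where
  "separated \<gamma> A B \<longleftrightarrow>
    (\<forall>p<length \<gamma>. \<forall>q<length \<gamma>. \<gamma> ! p \<inter> A \<noteq> {} \<and> \<gamma> ! q \<inter> B \<noteq> {} \<longrightarrow> p < q)"

lemma separated_append:
  assumes "\<pi> \<in> set_compositions A" and "\<tau> \<in> set_compositions B" and "A \<inter> B = {}"
  shows "separated (\<pi> @ \<tau>) A B"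
  unfolding separated_def
proof (intro allI impI)
  fix p q assume p: "p < length (\<pi> @ \<tau>)" and q: "q < length (\<pi> @ \<tau>)"
    and meet: "(\<pi> @ \<tau>) ! p \<inter> A \<noteq> {} \<and> (\<pi> @ \<tau>) ! q \<inter> B \<noteq> {}"
  have \<pi>: "S \<inter> B = {}" if "S \<in> set \<pi>" for S
    using that set_compositionsD(3)[OF assms(1)] assms(3) by auto
  have \<tau>: "S \<inter> A = {}" if "S \<in> set \<tau>" for S
    using that set_compositionsD(3)[OF assms(2)] assms(3) by auto
  have "p < length \<pi>"
  proof (rule ccontr)
    assume "\<not> p < length \<pi>"
    with p have "p - length \<pi> < length \<tau>" by simp
    from \<tau>[OF nth_mem[OF this]] meet \<open>\<not> p < length \<pi>\<close> show False
      by (simp add: nth_append)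
  qed
  moreover have "\<not> q < length \<pi>"
    using meet \<pi>[OF nth_mem, of q] by (auto simp: nth_append)
  ultimately show "p < q" by simp
qed

text \<open>A first block that misses \<open>B\<close> lies in \<open>A\<close> and is split off. As
  soon as a first block meets \<open>B\<close>, no block from there on can meet \<open>A\<close>, so
  the rest belongs to the restriction to \<open>B\<close>.\<close>

lemma separated_eq_append:
  assumes "{} \<notin> set \<gamma>" and "\<Union>(set \<gamma>) \<subseteq> A \<union> B" and "separated \<gamma> A B"
  shows "\<gamma> = restrict_comp \<gamma> A @ restrict_comp \<gamma> B"
  using assms
proof (induction \<gamma>)
  case Nil
  then show ?case by (simp add: restrict_comp_def)
next
  case (Cons S \<gamma>)
  show ?case
  proof (cases "S \<inter> B = {}")
    case True
    have "separated \<gamma> A B"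
      unfolding separated_def
    proof (intro allI impI)
      fix p q assume "p < length \<gamma>" "q < length \<gamma>" "\<gamma> ! p \<inter> A \<noteq> {} \<and> \<gamma> ! q \<inter> B \<noteq> {}"
      then have "Suc p < Suc q"
        using Cons.prems(3)[unfolded separated_def, rule_format, of "Suc p" "Suc q"] by simp
      then show "p < q" by simp
    qed
    with Cons have "\<gamma> = restrict_comp \<gamma> A @ restrict_comp \<gamma> B" by auto
    moreover have "S \<inter> A = S" "S \<noteq> {}" using Cons.prems True by auto
    ultimately show ?thesis using True by (simp add: restrict_comp_def)
  next
    case False
    have A: "T \<inter> A = {}" if T: "T \<in> set (S # \<gamma>)" for T
    proof (rule ccontr)
      assume "T \<inter> A \<noteq> {}"
      obtain p where "p < length (S # \<gamma>)" "(S # \<gamma>) ! p = T"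
        using T unfolding in_set_conv_nth by blast
      \<comment> \<open>The block at position 0 meets \<open>B\<close>, so separation would put the
        block \<open>T\<close> strictly before it.\<close>
      then have "p < 0"
        using \<open>T \<inter> A \<noteq> {}\<close> False Cons.prems(3)[unfolded separated_def, rule_format, of p 0]
        by simp
      then show False by simp
    qed
    have "map (\<lambda>T. T \<inter> B) (S # \<gamma>) = map id (S # \<gamma>)"
    proof (intro map_cong refl)
      fix T assume "T \<in> set (S # \<gamma>)"
      then show "T \<inter> B = id T" using A[of T] Cons.prems(2) by fastforce
    qed
    then have "restrict_comp (S # \<gamma>) B = S # \<gamma>"
      using Cons.prems(1) unfolding restrict_comp_def by (auto simp: filter_id_conv)
    moreover have "restrict_comp (S # \<gamma>) A = []"
      using A unfolding restrict_comp_def by (auto simp: filter_empty_conv)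
    ultimately show ?thesis by simp
  qed
qed

text \<open>Among all compositions of \<open>A \<union> B\<close>, exactly the concatenation
  contributes the tensor of the basis vectors of \<open>\<pi>\<close> and \<open>\<tau>\<close> to
  the coproduct.\<close>

lemma separated_restrict_iff:
  assumes "\<gamma> \<in> set_compositions (A \<union> B)" and "A \<inter> B = {}"
    and "\<pi> \<in> set_compositions A" and "\<tau> \<in> set_compositions B"
  shows "separated \<gamma> A B \<and> restrict_comp \<gamma> A = \<pi> \<and> restrict_comp \<gamma> B = \<tau> \<longleftrightarrow> \<gamma> = \<pi> @ \<tau>"
proof
  assume "separated \<gamma> A B \<and> restrict_comp \<gamma> A = \<pi> \<and> restrict_comp \<gamma> B = \<tau>"
  then show "\<gamma> = \<pi> @ \<tau>"
    using separated_eq_append[OF set_compositionsD(1)[OF assms(1)], of A B] set_compositionsD(3)[OF assms(1)]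
    by auto
next
  assume "\<gamma> = \<pi> @ \<tau>"
  then show "separated \<gamma> A B \<and> restrict_comp \<gamma> A = \<pi> \<and> restrict_comp \<gamma> B = \<tau>"
    using separated_append[OF assms(3,4,2)] assms(2)
      restrict_comp_superset[OF assms(3), of A] restrict_comp_superset[OF assms(4), of B]
      restrict_comp_disjoint[OF assms(3), of B] restrict_comp_disjoint[OF assms(4), of A]
    by (auto simp: restrict_comp_append Int_commute)
qed

text \<open>The witness takes preimages within \<open>I\<close> of the blocks. They are disjoint
  again, and each block, being contained in the image of \<open>I\<close>, is recovered from its
  preimage.\<close>

lemma set_composition_image_obtain:
  assumes "\<tau> \<in> set_compositions (\<sigma> ` I)"
  obtains \<pi> where "\<pi> \<in> set_compositions I" and "\<tau> = map ((`) \<sigma>) \<pi>"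
proof
  let ?\<pi> = "map (\<lambda>T. I \<inter> \<sigma> -` T) \<tau>"
  have im: "\<sigma> ` (I \<inter> \<sigma> -` T) = T" if "T \<in> set \<tau>" for T
  proof -
    have "T \<subseteq> \<sigma> ` I" using that set_compositionsD(3)[OF assms] by auto
    then show ?thesis by blast
  qed
  then have "map (\<lambda>T. \<sigma> ` (I \<inter> \<sigma> -` T)) \<tau> = map id \<tau>"
    by (intro map_cong) auto
  then show "\<tau> = map ((`) \<sigma>) ?\<pi>" by (simp add: comp_def)
  have "sorted_wrt (\<lambda>S T. disjnt (I \<inter> \<sigma> -` S) (I \<inter> \<sigma> -` T)) \<tau>"
    by (rule sorted_wrt_mono_rel[OF _ set_compositionsD(2)[OF assms]]) (auto simp: disjnt_iff)
  moreover have "{} \<notin> set ?\<pi>"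
    using im set_compositionsD(1)[OF assms] by fastforce
  moreover have "\<Union>(set ?\<pi>) = I"
    using set_compositionsD(3)[OF assms] by auto
  ultimately show "?\<pi> \<in> set_compositions I"
    by (simp add: set_compositions_def sorted_wrt_map)
qed

lemma map_image_set_composition_inj:
  assumes "inj_on \<sigma> I" and "\<pi> \<in> set_compositions I" and "\<rho> \<in> set_compositions I"
    and "map ((`) \<sigma>) \<pi> = map ((`) \<sigma>) \<rho>"
  shows "\<pi> = \<rho>"
proof (rule map_inj_on[OF assms(4)])
  have "set \<pi> \<union> set \<rho> \<subseteq> Pow I"
    using set_compositionsD(3)[OF assms(2)] set_compositionsD(3)[OF assms(3)] by auto
  then show "inj_on ((`) \<sigma>) (set \<pi> \<union> set \<rho>)"
    by (rule inj_on_subset[OF inj_on_image_Pow[OF assms(1)]])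
qed


section \<open>Coefficients in WQSym\<close>

lemma sum_fun_apply: "(\<Sum>i\<in>A. f i) x = (\<Sum>i\<in>A. f i x)" for f :: "'i \<Rightarrow> 'x \<Rightarrow> 'b::comm_monoid_add"
  by (induction A rule: infinite_finite_induct) auto

lemma scl_wqsym [simp]: "scl (wqsym_obj I) = fscale"
  by (simp add: wqsym_obj_def)

lemma is_vec_wqsym: "is_vec (wqsym_obj I :: ('k::field, 'a set list \<Rightarrow> 'k) vec)"
proof -
  interpret F: vector_space "fscale :: 'k \<Rightarrow> ('a set list \<Rightarrow> 'k) \<Rightarrow> _" by (rule vector_space_fscale)
  show ?thesis
    unfolding is_vec_def wqsym_obj_def by (simp add: F.vector_space_axioms)
qed

lemma mono_basis_in_wqsym: "\<pi> \<in> set_compositions I \<Longrightarrow> mono_basis \<pi> \<in> car (wqsym_obj I)"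
  for I :: "'a set"
proof -
  interpret F: vector_space "fscale :: 'k::field \<Rightarrow> ('a set list \<Rightarrow> 'k) \<Rightarrow> _" by (rule vector_space_fscale)
  assume "\<pi> \<in> set_compositions I"
  then show "(mono_basis \<pi> :: 'a set list \<Rightarrow> 'k) \<in> car (wqsym_obj I)"
    unfolding wqsym_obj_def by (auto intro: F.span_base)
qed

lemma mono_basis_expansion:
  assumes "finite I" and "\<And>\<pi>. \<pi> \<notin> set_compositions I \<Longrightarrow> f \<pi> = 0"
  shows "f = (\<Sum>\<pi>\<in>set_compositions I. fscale (f \<pi>) (mono_basis \<pi>))"
proof
  fix \<tau>
  have "(\<Sum>\<pi>\<in>set_compositions I. fscale (f \<pi>) (mono_basis \<pi>)) \<tau> =
      (\<Sum>\<pi>\<in>set_compositions I. if \<pi> = \<tau> then f \<tau> else 0)"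
    unfolding sum_fun_apply by (rule sum.cong) (auto simp: fscale_def mono_basis_def)
  then show "f \<tau> = (\<Sum>\<pi>\<in>set_compositions I. fscale (f \<pi>) (mono_basis \<pi>)) \<tau>"
    using assms(2)[of \<tau>] finite_set_compositions[OF assms(1)] by auto
qed

text \<open>A finite set has finitely many compositions, so the span of the indicators contains
  every function supported on them. Membership becomes a support condition.\<close>

lemma wqsym_iff:
  fixes f :: "'a set list \<Rightarrow> 'k::field"
  assumes "finite I"
  shows "f \<in> car (wqsym_obj I) \<longleftrightarrow> (\<forall>\<pi>. \<pi> \<notin> set_compositions I \<longrightarrow> f \<pi> = 0)"
proof
  interpret F: vector_space "fscale :: 'k \<Rightarrow> ('a set list \<Rightarrow> 'k) \<Rightarrow> _" by (rule vector_space_fscale)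
  assume "f \<in> car (wqsym_obj I)"
  then have "f \<in> F.span (mono_basis ` set_compositions I)" by (simp add: wqsym_obj_def)
  then show "\<forall>\<pi>. \<pi> \<notin> set_compositions I \<longrightarrow> f \<pi> = 0"
    by (induction rule: F.span_induct_alt) (auto simp: fscale_def mono_basis_def split: if_splits)
next
  assume *: "\<forall>\<pi>. \<pi> \<notin> set_compositions I \<longrightarrow> f \<pi> = 0"
  have "(\<Sum>\<pi>\<in>set_compositions I. fscale (f \<pi>) (mono_basis \<pi>)) \<in> car (wqsym_obj I)"
    using is_vec_closed(3)[OF is_vec_wqsym mono_basis_in_wqsym]
    by (intro is_vec_sum is_vec_wqsym) (simp only: scl_wqsym)
  then show "f \<in> car (wqsym_obj I)"
    using mono_basis_expansion[OF assms, of f] * by simp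
qed

lemma coefficient_linear: "linear_map (wqsym_obj I) ground (\<lambda>f. f \<pi>)"
  by (auto simp: linear_map_def fscale_def)

lemma basis_extend_linear:
  assumes "is_vec U" and "\<And>\<pi>. \<pi> \<in> set_compositions I \<Longrightarrow> F \<pi> \<in> car U"
  shows "linear_map (wqsym_obj I) U (basis_extend U I F)"
proof -
  interpret U: vector_space "scl U" using assms(1) by (simp add: is_vec_def)
  show ?thesis
    unfolding linear_map_def basis_extend_def
    by (auto intro!: is_vec_sum is_vec_closed(3) assms
        simp: fscale_def U.scale_left_distrib sum.distrib U.scale_sum_right)
qed

text \<open>Pairs of coefficient forms separate tensors, because a tensor can be rebuilt from its
  finitely many coefficients.\<close>

lemma tensor_coefficients_eqI:
  fixes s t :: "('a set list \<Rightarrow> 'k::field, 'a set list \<Rightarrow> 'k, 'k) tensor"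
  assumes fin: "finite A" "finite B"
    and s: "s \<in> car (wqsym_obj A \<otimes> wqsym_obj B)" and t: "t \<in> car (wqsym_obj A \<otimes> wqsym_obj B)"
    and eq: "\<And>\<pi> \<tau>. \<pi> \<in> set_compositions A \<Longrightarrow> \<tau> \<in> set_compositions B \<Longrightarrow>
      tensor_form (wqsym_obj A) (wqsym_obj B) (\<lambda>f. f \<pi>) (\<lambda>g. g \<tau>) s =
      tensor_form (wqsym_obj A) (wqsym_obj B) (\<lambda>f. f \<pi>) (\<lambda>g. g \<tau>) t"
  shows "s = t"
proof -
  let ?V = "wqsym_obj A :: ('k, 'a set list \<Rightarrow> 'k) vec"
  let ?W = "wqsym_obj B :: ('k, 'a set list \<Rightarrow> 'k) vec"
  let ?c = "\<lambda>\<pi> \<tau>. tensor_form ?V ?W (\<lambda>f. f \<pi>) (\<lambda>g. g \<tau>)"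
  \<comment> \<open>The expansion of \<open>u\<close> in pure tensors of basis vectors. It is linear
    and fixes every pure tensor, hence is the identity on the tensor product.\<close>
  let ?E = "\<lambda>u. \<Sum>\<pi>\<in>set_compositions A. \<Sum>\<tau>\<in>set_compositions B.
      fscale (?c \<pi> \<tau> u) (pure ?V ?W (mono_basis \<pi>) (mono_basis \<tau>))"
  interpret F: vector_space "fscale :: 'k \<Rightarrow> ('a set list \<Rightarrow> 'k, 'a set list \<Rightarrow> 'k, 'k) tensor \<Rightarrow> _"
    by (rule vector_space_fscale)
  note c = tensor_form_linear[OF is_vec_wqsym is_vec_wqsym coefficient_linear coefficient_linear]
  have p: "fscale a (pure ?V ?W (mono_basis \<pi>) (mono_basis \<tau>)) \<in> car (?V \<otimes> ?W)"
    if "\<pi> \<in> set_compositions A" "\<tau> \<in> set_compositions B" for \<pi> \<tau> a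
    using is_vec_closed(3)[OF is_vec_tensor pure_in_tensor[OF that[THEN mono_basis_in_wqsym]]]
    by simp
  have lin: "linear_map (?V \<otimes> ?W) (?V \<otimes> ?W) ?E"
    unfolding linear_map_def
  proof (intro conjI ballI allI funcsetI)
    show "?E u \<in> car (?V \<otimes> ?W)" if "u \<in> car (?V \<otimes> ?W)" for u
      by (intro is_vec_sum is_vec_tensor p)
    show "?E (u + u') = ?E u + ?E u'" if "u \<in> car (?V \<otimes> ?W)" "u' \<in> car (?V \<otimes> ?W)" for u u'
      using linear_mapD(2)[OF c(1) that] by (simp add: F.scale_left_distrib sum.distrib)
    show "?E (scl (?V \<otimes> ?W) a u) = scl (?V \<otimes> ?W) a (?E u)" if "u \<in> car (?V \<otimes> ?W)" for a u
      using linear_mapD(3)[OF c(1) that] by (simp add: F.scale_sum_right)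
  qed
  have E: "?E u = u" if "u \<in> car (?V \<otimes> ?W)" for u
  proof (rule tensor_map_unique[OF is_vec_tensor lin linear_map_id(2) _ that])
    fix f g assume f: "f \<in> car ?V" and g: "g \<in> car ?W"
    have exp: "f = (\<Sum>\<pi>\<in>set_compositions A. scl ?V (f \<pi>) (mono_basis \<pi>))"
      "g = (\<Sum>\<tau>\<in>set_compositions B. scl ?W (g \<tau>) (mono_basis \<tau>))"
      using mono_basis_expansion[OF fin(1)] mono_basis_expansion[OF fin(2)] f g
      by (auto simp: wqsym_iff fin)
    note l = linear_map_pure(1)[OF is_vec_wqsym[of A] is_vec_wqsym[of B]]
      and r = linear_map_pure(2)[OF is_vec_wqsym[of A] is_vec_wqsym[of B]]
    have "pure ?V ?W f g =
        (\<Sum>\<pi>\<in>set_compositions A. fscale (f \<pi>) (pure ?V ?W (mono_basis \<pi>) g))"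
      by (subst exp(1), subst linear_map_sum[OF l[OF g] is_vec_wqsym is_vec_tensor])
        (use g in \<open>auto simp: mono_basis_in_wqsym linear_mapD(3)[OF l] simp del: scl_wqsym
          intro!: is_vec_closed(3) is_vec_wqsym sum.cong\<close>)
    also have "\<dots> = (\<Sum>\<pi>\<in>set_compositions A. fscale (f \<pi>)
        (\<Sum>\<tau>\<in>set_compositions B. fscale (g \<tau>) (pure ?V ?W (mono_basis \<pi>) (mono_basis \<tau>))))"
    proof (intro sum.cong refl arg_cong[where f = "fscale _"])
      fix \<pi> assume \<pi>: "\<pi> \<in> set_compositions A"
      show "pure ?V ?W (mono_basis \<pi>) g =
          (\<Sum>\<tau>\<in>set_compositions B. fscale (g \<tau>) (pure ?V ?W (mono_basis \<pi>) (mono_basis \<tau>)))"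
        by (subst exp(2), subst linear_map_sum[OF r[OF mono_basis_in_wqsym[OF \<pi>]] is_vec_wqsym is_vec_tensor])
          (use \<pi> in \<open>auto simp: mono_basis_in_wqsym linear_mapD(3)[OF r] simp del: scl_wqsym
            intro!: is_vec_closed(3) is_vec_wqsym sum.cong\<close>)
    qed
    also have "\<dots> = ?E (pure ?V ?W f g)"
      by (simp only: c(2)[OF f g] F.scale_sum_right F.scale_scale)
    finally show "?E (pure ?V ?W f g) = pure ?V ?W f g" by (rule sym)
  qed
  have "?E s = ?E t" using eq by simp
  then show ?thesis by (simp only: E s t)
qed

section \<open>The structure maps of WQSym in coefficients\<close>

lemma obj_WQSym: "obj WQSym = wqsym_obj"
  by (simp add: WQSym_def)

text \<open>A composition of a non-empty set with at most one block is \<open>[S]\<close>.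
  Compatibility with characters thus becomes a condition on single coefficients.\<close>

lemma eta0_nonempty:
  assumes "finite S" and "S \<noteq> {}"
  shows "eta0 S f = f [S]"
proof -
  have "eta0 S f = (\<Sum>\<pi>\<in>set_compositions S. if \<pi> = [S] then f [S] else 0)"
    unfolding eta0_def basis_extend_def
  proof (rule sum.cong[OF refl])
    fix \<pi> assume \<pi>: "\<pi> \<in> set_compositions S"
    have "length \<pi> \<le> 1 \<longleftrightarrow> \<pi> = [S]"
    proof
      show "length \<pi> \<le> 1 \<Longrightarrow> \<pi> = [S]" by (rule set_compositions_length_le_1[OF assms(2) \<pi>])
    qed simp
    then show "scl ground (f \<pi>) (if length \<pi> \<le> 1 then 1 else 0) = (if \<pi> = [S] then f [S] else 0)"
      by simp
  qed
  then show ?thesis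
    using finite_set_compositions[OF assms(1)] singleton_set_composition[OF assms(2)] by simp
qed

lemma eta0_empty: "eta0 {} f = f []"
  by (simp add: eta0_def basis_extend_def set_compositions_empty)

lemma eps_WQSym: "eps WQSym f = f []"
  by (simp add: WQSym_def basis_extend_def set_compositions_empty)

lemma Delta_WQSym:
  "Delta WQSym A B = basis_extend (wqsym_obj A \<otimes> wqsym_obj B) (A \<union> B)
    (\<lambda>\<gamma>. if separated \<gamma> A B
      then pure (wqsym_obj A) (wqsym_obj B) (mono_basis (restrict_comp \<gamma> A)) (mono_basis (restrict_comp \<gamma> B))
      else 0)"
  by (simp add: WQSym_def separated_def)

lemma Delta_WQSym_linear:
  "linear_map (wqsym_obj (A \<union> B)) (wqsym_obj A \<otimes> wqsym_obj B) (Delta WQSym A B)"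
  unfolding Delta_WQSym
  by (rule basis_extend_linear[OF is_vec_tensor])
    (auto intro!: pure_in_tensor mono_basis_in_wqsym is_vec_closed(1) is_vec_tensor
      intro: restrict_set_composition)

text \<open>The coproduct is deconcatenation, so coefficient forms convolve by concatenating their
  indices. Hence the coefficient at a composition is determined by one-block coefficients on its
  blocks.\<close>

lemma convolution_WQSym:
  fixes f :: "'a set list \<Rightarrow> 'k::field"
  assumes fin: "finite A" "finite B" and dis: "A \<inter> B = {}"
    and \<pi>: "\<pi> \<in> set_compositions A" and \<tau>: "\<tau> \<in> set_compositions B"
  shows "convolution WQSym A B (\<lambda>f. f \<pi>) (\<lambda>g. g \<tau>) f = f (\<pi> @ \<tau>)"
proof -
  let ?V = "wqsym_obj A :: ('k, 'a set list \<Rightarrow> 'k) vec"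
  let ?W = "wqsym_obj B :: ('k, 'a set list \<Rightarrow> 'k) vec"
  let ?c = "tensor_form ?V ?W (\<lambda>f. f \<pi>) (\<lambda>g. g \<tau>)"
  let ?G = "\<lambda>\<gamma>. if separated \<gamma> A B
      then pure ?V ?W (mono_basis (restrict_comp \<gamma> A)) (mono_basis (restrict_comp \<gamma> B)) else 0"
  note c = tensor_form_linear[OF is_vec_wqsym[of A] is_vec_wqsym[of B] coefficient_linear[of A \<pi>]
      coefficient_linear[of B \<tau>]]
  have G: "?G \<gamma> \<in> car (?V \<otimes> ?W)" if "\<gamma> \<in> set_compositions (A \<union> B)" for \<gamma>
    using that by (auto intro!: pure_in_tensor mono_basis_in_wqsym is_vec_closed(1) is_vec_tensor
      intro: restrict_set_composition)
  \<comment> \<open>Among the images of the basis vectors, a single one has a non-zero coefficient,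
    so the sum over all \<open>\<gamma>\<close> collapses.\<close>
  have cG: "?c (?G \<gamma>) = (if \<gamma> = \<pi> @ \<tau> then 1 else 0)" if \<gamma>: "\<gamma> \<in> set_compositions (A \<union> B)" for \<gamma>
  proof -
    have r: "restrict_comp \<gamma> A \<in> set_compositions A" "restrict_comp \<gamma> B \<in> set_compositions B"
      using restrict_set_composition[OF \<gamma>] by auto
    have "?c 0 = 0" by (rule linear_map_zero[OF c(1) is_vec_tensor is_vec_ground])
    moreover have "?c (pure ?V ?W (mono_basis (restrict_comp \<gamma> A)) (mono_basis (restrict_comp \<gamma> B))) =
        (if restrict_comp \<gamma> A = \<pi> \<and> restrict_comp \<gamma> B = \<tau> then 1 else 0)"
      by (subst c(2)[OF r[THEN mono_basis_in_wqsym]]) (simp add: mono_basis_def)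
    ultimately have "?c (?G \<gamma>) =
        (if separated \<gamma> A B \<and> restrict_comp \<gamma> A = \<pi> \<and> restrict_comp \<gamma> B = \<tau> then 1 else 0)"
      by (cases "separated \<gamma> A B") (simp_all only: if_True if_False simp_thms)
    then show ?thesis by (simp only: separated_restrict_iff[OF \<gamma> dis \<pi> \<tau>])
  qed
  have "convolution WQSym A B (\<lambda>f. f \<pi>) (\<lambda>g. g \<tau>) f =
      ?c (\<Sum>\<gamma>\<in>set_compositions (A \<union> B). scl (?V \<otimes> ?W) (f \<gamma>) (?G \<gamma>))"
    unfolding convolution_def obj_WQSym Delta_WQSym basis_extend_def ..
  also have "\<dots> = (\<Sum>\<gamma>\<in>set_compositions (A \<union> B). ?c (scl (?V \<otimes> ?W) (f \<gamma>) (?G \<gamma>)))"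
    by (intro linear_map_sum[OF c(1) is_vec_tensor is_vec_ground] is_vec_closed(3)[OF is_vec_tensor] G)
  also have "\<dots> = (\<Sum>\<gamma>\<in>set_compositions (A \<union> B). if \<gamma> = \<pi> @ \<tau> then f \<gamma> else 0)"
    by (rule sum.cong[OF refl], subst linear_mapD(3)[OF c(1) G], assumption) (simp add: cG)
  also have "\<dots> = f (\<pi> @ \<tau>)"
    using append_set_composition[OF \<pi> \<tau> dis] finite_set_compositions[of "A \<union> B"] fin by simp
  finally show ?thesis .
qed

text \<open>A composition \<open>\<gamma>\<close> occurs in the product of the basis vectors of
  exactly one pair, its restrictions to \<open>A\<close> and \<open>B\<close>. So the double sum for
  the coefficient at \<open>\<gamma>\<close> has a single surviving term.\<close>

lemma mu_WQSym:
  fixes f g :: "'a set list \<Rightarrow> 'k::field"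
  assumes fin: "finite A" "finite B"
  shows "linear_map (wqsym_obj A \<otimes> wqsym_obj B) (wqsym_obj (A \<union> B))
      (mu WQSym A B :: ('a set list \<Rightarrow> 'k, 'a set list \<Rightarrow> 'k, 'k) tensor \<Rightarrow> _)"
    and "f \<in> car (wqsym_obj A) \<Longrightarrow> g \<in> car (wqsym_obj B) \<Longrightarrow>
      mu WQSym A B (pure (wqsym_obj A) (wqsym_obj B) f g) \<gamma> =
      (if \<gamma> \<in> set_compositions (A \<union> B) then f (restrict_comp \<gamma> A) * g (restrict_comp \<gamma> B) else 0)"
proof -
  let ?U = "wqsym_obj (A \<union> B) :: ('k, 'a set list \<Rightarrow> 'k) vec"
  let ?P = "\<lambda>f g. basis_extend ?U A (\<lambda>\<pi>. basis_extend ?U B (\<lambda>\<tau>.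
      \<Sum>\<gamma> | \<gamma> \<in> set_compositions (A \<union> B) \<and> restrict_comp \<gamma> A = \<pi> \<and> restrict_comp \<gamma> B = \<tau>.
        mono_basis \<gamma>) g) f"
  have finAB: "finite (A \<union> B)" using fin by simp
  have P: "?P f g \<gamma> =
      (if \<gamma> \<in> set_compositions (A \<union> B) then f (restrict_comp \<gamma> A) * g (restrict_comp \<gamma> B) else 0)"
    for f g \<gamma>
  proof -
    have coeff: "(\<Sum>\<gamma>' | \<gamma>' \<in> set_compositions (A \<union> B) \<and> restrict_comp \<gamma>' A = \<pi> \<and> restrict_comp \<gamma>' B = \<tau>.
          mono_basis \<gamma>' \<gamma>) =
        (if \<gamma> \<in> set_compositions (A \<union> B) \<and> restrict_comp \<gamma> A = \<pi> \<and> restrict_comp \<gamma> B = \<tau> then 1 else 0 :: 'k)"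
      for \<pi> \<tau>
      using finite_set_compositions[OF finAB] by (simp add: mono_basis_def)
    have "?P f g \<gamma> = (\<Sum>\<pi>\<in>set_compositions A. f \<pi> * (\<Sum>\<tau>\<in>set_compositions B. g \<tau> *
        (if \<gamma> \<in> set_compositions (A \<union> B) \<and> restrict_comp \<gamma> A = \<pi> \<and> restrict_comp \<gamma> B = \<tau> then 1 else 0)))"
      unfolding basis_extend_def scl_wqsym by (simp only: sum_fun_apply fscale_def coeff)
    also have "\<dots> = (if \<gamma> \<in> set_compositions (A \<union> B)
        then f (restrict_comp \<gamma> A) * g (restrict_comp \<gamma> B) else 0)"
    proof (cases "\<gamma> \<in> set_compositions (A \<union> B)")
      case True
      have r: "restrict_comp \<gamma> A \<in> set_compositions A" "restrict_comp \<gamma> B \<in> set_compositions B"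
        using restrict_set_composition[OF True] by auto
      have "(\<Sum>\<tau>\<in>set_compositions B. g \<tau> * (if \<gamma> \<in> set_compositions (A \<union> B) \<and>
          restrict_comp \<gamma> A = \<pi> \<and> restrict_comp \<gamma> B = \<tau> then 1 else 0)) =
          (if restrict_comp \<gamma> A = \<pi> then g (restrict_comp \<gamma> B) else 0)" for \<pi>
      proof -
        have "(\<Sum>\<tau>\<in>set_compositions B. g \<tau> * (if \<gamma> \<in> set_compositions (A \<union> B) \<and>
            restrict_comp \<gamma> A = \<pi> \<and> restrict_comp \<gamma> B = \<tau> then 1 else 0)) =
            (\<Sum>\<tau>\<in>set_compositions B. if \<tau> = restrict_comp \<gamma> B
              then (if restrict_comp \<gamma> A = \<pi> then g (restrict_comp \<gamma> B) else 0) else 0)"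
          by (rule sum.cong) (use True in auto)
        then show ?thesis using r finite_set_compositions[OF fin(2)] by simp
      qed
      then have "(\<Sum>\<pi>\<in>set_compositions A. f \<pi> * (\<Sum>\<tau>\<in>set_compositions B. g \<tau> *
          (if \<gamma> \<in> set_compositions (A \<union> B) \<and> restrict_comp \<gamma> A = \<pi> \<and> restrict_comp \<gamma> B = \<tau> then 1 else 0))) =
          (\<Sum>\<pi>\<in>set_compositions A. if \<pi> = restrict_comp \<gamma> A
            then f (restrict_comp \<gamma> A) * g (restrict_comp \<gamma> B) else 0)"
        by (intro sum.cong) auto
      then show ?thesis
        using True r finite_set_compositions[OF fin(1)] by simp
    qed simp
    finally show ?thesis .
  qed
  \<comment> \<open>The nested sums are hidden behind a constant, so that bilinearity is proved from
    the closed formula for the coefficients.\<close>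
  define p where "p = ?P"
  have p: "p f g = (\<lambda>\<gamma>. if \<gamma> \<in> set_compositions (A \<union> B)
      then f (restrict_comp \<gamma> A) * g (restrict_comp \<gamma> B) else 0)" for f g
    unfolding p_def by (rule ext) (rule P)
  have B: "bilinear_map (wqsym_obj A) (wqsym_obj B) ?U p"
    unfolding bilinear_map_def linear_map_def
    by (auto simp: wqsym_iff[OF finAB] p fun_eq_iff fscale_def algebra_simps)
  have mu: "mu WQSym A B = tensor_lift (wqsym_obj A) (wqsym_obj B) ?U p"
    by (simp add: WQSym_def p_def)
  note L = tensor_lift_universal[OF is_vec_wqsym is_vec_wqsym is_vec_wqsym B, folded mu]
  show "linear_map (wqsym_obj A \<otimes> wqsym_obj B) ?U (mu WQSym A B)"
    by (rule L(1))
  show "mu WQSym A B (pure (wqsym_obj A) (wqsym_obj B) f g) \<gamma> =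
      (if \<gamma> \<in> set_compositions (A \<union> B) then f (restrict_comp \<gamma> A) * g (restrict_comp \<gamma> B) else 0)"
    if "f \<in> car (wqsym_obj A)" "g \<in> car (wqsym_obj B)"
    by (simp only: L(2)[OF that] p)
qed

text \<open>Injectivity of \<open>\<sigma>\<close> on \<open>I\<close> leaves one contributing
  summand. Together with \<open>act_WQSym_outside\<close> this determines every coefficient of a
  relabelled vector.\<close>

lemma act_WQSym_coefficient:
  assumes "finite I" and "inj_on \<sigma> I" and "\<pi> \<in> set_compositions I"
  shows "act WQSym \<sigma> I f (map ((`) \<sigma>) \<pi>) = f \<pi>"
proof -
  have "act WQSym \<sigma> I f (map ((`) \<sigma>) \<pi>) = (\<Sum>\<rho>\<in>set_compositions I. if \<rho> = \<pi> then f \<pi> else 0)"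
  proof -
    have "map ((`) \<sigma>) \<pi> = map ((`) \<sigma>) \<rho> \<longleftrightarrow> \<rho> = \<pi>" if "\<rho> \<in> set_compositions I" for \<rho>
      using map_image_set_composition_inj[OF assms(2,3) that] by blast
    then show ?thesis
      by (auto simp: WQSym_def basis_extend_def sum_fun_apply fscale_def mono_basis_def intro!: sum.cong)
  qed
  then show ?thesis
    using finite_set_compositions[OF assms(1)] assms(3) by simp
qed

lemma act_WQSym_outside:
  fixes f :: "'a set list \<Rightarrow> 'k::field"
  assumes "\<tau> \<notin> set_compositions (\<sigma> ` I)" and "inj_on \<sigma> I"
  shows "act WQSym \<sigma> I f \<tau> = 0"
proof -
  have "map ((`) \<sigma>) \<pi> \<in> set_compositions (\<sigma> ` I)" if "\<pi> \<in> set_compositions I" for \<pi>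
  proof -
    have "sorted_wrt (\<lambda>S T. disjnt (\<sigma> ` S) (\<sigma> ` T)) \<pi>"
    proof (rule sorted_wrt_mono_rel[OF _ set_compositionsD(2)[OF that]])
      fix S T assume "S \<in> set \<pi>" "T \<in> set \<pi>" "disjnt S T"
      then show "disjnt (\<sigma> ` S) (\<sigma> ` T)"
        using inj_on_image_Int[OF assms(2), of S T] set_compositionsD(3)[OF that]
        by (auto simp: disjnt_def)
    qed
    then show ?thesis
      using that by (auto simp: set_compositions_def sorted_wrt_map)
  qed
  then have "mono_basis (map ((`) \<sigma>) \<pi>) \<tau> = (0 :: 'k)" if "\<pi> \<in> set_compositions I" for \<pi>
    using that assms(1) by (auto simp: mono_basis_def)
  then show ?thesis
    unfolding WQSym_def basis_extend_def by (simp add: sum_fun_apply fscale_def)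
qed

section \<open>The universal morphism\<close>

text \<open>Restricting both arguments gives the extensionality under which uniqueness is stated,
  and the value 0 off the compositions of \<open>I\<close> puts the result into the carrier of
  WQSym.\<close>

definition upsilon ::
    "('a, 'k::field, 'v::ab_group_add, 'm) bimonoid_species_scheme \<Rightarrow> ('a set \<Rightarrow> 'v \<Rightarrow> 'k)
      \<Rightarrow> 'a set \<Rightarrow> 'v \<Rightarrow> 'a set list \<Rightarrow> 'k" where
  "upsilon H \<eta> = (\<lambda>I\<in>{I. finite I}. \<lambda>x\<in>car (obj H I).
    (\<lambda>\<pi>. if \<pi> \<in> set_compositions I then iterated_form H \<eta> \<pi> x else 0))"

context combinatorial_bimonoid
begin

section \<open>Existence: the coefficient formula defines a morphism\<close>

lemma upsilon_eq:
  assumes "finite I" and "x \<in> car (obj H I)"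
  shows "upsilon H \<eta> I x = (\<lambda>\<pi>. if \<pi> \<in> set_compositions I then iterated_form H \<eta> \<pi> x else 0)"
  using assms by (simp add: upsilon_def)

lemma composition_form_linear:
  assumes "finite I" and "\<pi> \<in> set_compositions I"
  shows "linear_map (obj H I) ground (iterated_form H \<eta> \<pi>)"
  using iterated_form_linear[OF set_compositionsD(2)[OF assms(2)]] set_compositionsD(3)[OF assms(2)] assms(1)
  by simp

lemma upsilon_linear:
  assumes "finite I"
  shows "linear_map (obj H I) (wqsym_obj I) (upsilon H \<eta> I)"
  unfolding linear_map_def
proof (intro conjI ballI allI funcsetI)
  note l = linear_mapD[OF composition_form_linear[OF assms]] and c = is_vec_closed[OF vec[OF assms]]
  show "upsilon H \<eta> I x \<in> car (wqsym_obj I)" if "x \<in> car (obj H I)" for x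
    using that by (simp add: wqsym_iff assms upsilon_eq)
  show "upsilon H \<eta> I (x + y) = upsilon H \<eta> I x + upsilon H \<eta> I y"
    if "x \<in> car (obj H I)" "y \<in> car (obj H I)" for x y
    using that by (auto simp: upsilon_eq assms c l)
  show "upsilon H \<eta> I (scl (obj H I) a x) = scl (wqsym_obj I) a (upsilon H \<eta> I x)"
    if "x \<in> car (obj H I)" for a x
    using that by (auto simp: upsilon_eq assms c l fscale_def)
qed

text \<open>Coefficients are compared: off the compositions of the image both sides vanish, and on
  it a composition is pulled back along \<open>\<sigma>\<close>, so that
  \<open>iterated_form_act\<close> applies.\<close>

lemma upsilon_species_morphism: "species_morphism H WQSym (upsilon H \<eta>)"
  unfolding species_morphism_def obj_WQSym
proof (intro conjI allI impI ballI)
  show "linear_map (obj H I) (wqsym_obj I) (upsilon H \<eta> I)" if "finite I" for I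
    by (rule upsilon_linear[OF that])
  fix I x and \<sigma> :: "'a \<Rightarrow> 'a"
  assume I: "finite I \<and> inj_on \<sigma> I" and x: "x \<in> car (obj H I)"
  have ax: "act H \<sigma> I x \<in> car (obj H (\<sigma> ` I))"
    using linear_mapD(1)[OF act_linear x] I by blast
  show "upsilon H \<eta> (\<sigma> ` I) (act H \<sigma> I x) = act WQSym \<sigma> I (upsilon H \<eta> I x)"
  proof
    fix \<tau>
    show "upsilon H \<eta> (\<sigma> ` I) (act H \<sigma> I x) \<tau> = act WQSym \<sigma> I (upsilon H \<eta> I x) \<tau>"
    proof (cases "\<tau> \<in> set_compositions (\<sigma> ` I)")
      case False
      then show ?thesis using I ax by (simp add: upsilon_eq act_WQSym_outside)
    next
      case True
      then obtain \<pi> where \<pi>: "\<pi> \<in> set_compositions I" "\<tau> = map ((`) \<sigma>) \<pi>"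
        by (rule set_composition_image_obtain)
      have "iterated_form H \<eta> (map ((`) \<sigma>) \<pi>) (act H \<sigma> I x) = iterated_form H \<eta> \<pi> x"
        using iterated_form_act[OF set_compositionsD(2)[OF \<pi>(1)], of \<sigma> x] I x
        unfolding set_compositionsD(3)[OF \<pi>(1)] by blast
      then show ?thesis
        using True I ax x \<pi> by (simp add: upsilon_eq act_WQSym_coefficient)
    qed
  qed
qed

text \<open>Both sides are tested against the coefficient forms at \<open>\<pi>\<close> and
  \<open>\<tau>\<close>. One side gives the iterated form of \<open>\<pi> @ \<tau>\<close>, the
  other the convolution of the two iterated forms, and these agree by
  \<open>iterated_form_append\<close>.\<close>

lemma upsilon_comonoid_morphism: "comonoid_morphism H WQSym (upsilon H \<eta>)"
  unfolding comonoid_morphism_def obj_WQSym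
proof (intro conjI allI impI ballI)
  show "species_morphism H WQSym (upsilon H \<eta>)" by (rule upsilon_species_morphism)
  show "eps WQSym (upsilon H \<eta> {} x) = eps H x" if "x \<in> car (obj H {})" for x
    using that by (simp add: eps_WQSym upsilon_eq set_compositions_empty eta_eps)
  fix A B x assume AB: "finite A \<and> finite B \<and> A \<inter> B = {}" and x: "x \<in> car (obj H (A \<union> B))"
  then have fin: "finite A" "finite B" and dis: "A \<inter> B = {}" by auto
  let ?T = "tensor_map (obj H A) (obj H B) (wqsym_obj A) (wqsym_obj B) (upsilon H \<eta> A) (upsilon H \<eta> B)"
  note ul = upsilon_linear[OF fin(1)] upsilon_linear[OF fin(2)]
  note T = tensor_map_linear(1)[OF vec[OF fin(1)] vec[OF fin(2)] is_vec_wqsym is_vec_wqsym ul]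
  have u: "upsilon H \<eta> (A \<union> B) x \<in> car (wqsym_obj (A \<union> B))"
    using linear_mapD(1)[OF upsilon_linear x] fin by simp
  have D: "Delta H A B x \<in> car (obj H A \<otimes> obj H B)"
    by (rule linear_mapD(1)[OF Delta_linear[OF fin dis] x])
  show "Delta WQSym A B (upsilon H \<eta> (A \<union> B) x) = ?T (Delta H A B x)"
  proof (rule tensor_coefficients_eqI[OF fin linear_mapD(1)[OF Delta_WQSym_linear u]
        linear_mapD(1)[OF T D]])
    fix \<pi> \<tau> assume \<pi>: "\<pi> \<in> set_compositions A" and \<tau>: "\<tau> \<in> set_compositions B"
    note \<pi>\<tau> = append_set_composition[OF \<pi> \<tau> dis]
    have "tensor_form (wqsym_obj A) (wqsym_obj B) (\<lambda>f. f \<pi>) (\<lambda>g. g \<tau>)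
        (Delta WQSym A B (upsilon H \<eta> (A \<union> B) x)) = upsilon H \<eta> (A \<union> B) x (\<pi> @ \<tau>)"
      using convolution_WQSym[OF fin dis \<pi> \<tau>] by (simp add: convolution_def obj_WQSym)
    also have "\<dots> = iterated_form H \<eta> (\<pi> @ \<tau>) x"
      using \<pi>\<tau> fin x by (simp add: upsilon_eq)
    also have "\<dots> = convolution H A B (iterated_form H \<eta> \<pi>) (iterated_form H \<eta> \<tau>) x"
      using iterated_form_append[OF set_compositionsD(2)[OF \<pi>\<tau>]] fin x
      unfolding set_compositionsD(3)[OF \<pi>\<tau>] set_compositionsD(3)[OF \<pi>] set_compositionsD(3)[OF \<tau>]
      by blast
    also have "\<dots> = convolution H A B (\<lambda>y. upsilon H \<eta> A y \<pi>) (\<lambda>z. upsilon H \<eta> B z \<tau>) x"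
      by (rule convolution_cong[OF fin dis composition_form_linear[OF fin(1) \<pi>]
            composition_form_linear[OF fin(2) \<tau>] _ _ x]) (simp_all add: upsilon_eq fin \<pi> \<tau>)
    also have "\<dots> = tensor_form (wqsym_obj A) (wqsym_obj B) (\<lambda>f. f \<pi>) (\<lambda>g. g \<tau>) (?T (Delta H A B x))"
      unfolding convolution_def
      by (rule tensor_form_map[OF vec[OF fin(1)] vec[OF fin(2)] is_vec_wqsym is_vec_wqsym ul
            coefficient_linear coefficient_linear D, symmetric])
    finally show "tensor_form (wqsym_obj A) (wqsym_obj B) (\<lambda>f. f \<pi>) (\<lambda>g. g \<tau>)
        (Delta WQSym A B (upsilon H \<eta> (A \<union> B) x)) =
      tensor_form (wqsym_obj A) (wqsym_obj B) (\<lambda>f. f \<pi>) (\<lambda>g. g \<tau>) (?T (Delta H A B x))" .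
  qed
qed

text \<open>Deleting the empty intersections in \<open>iterated_form_mu\<close> leaves the
  restrictions that index the product of WQSym.\<close>

lemma iterated_form_mu_restrict:
  assumes \<gamma>: "\<gamma> \<in> set_compositions (A \<union> B)" and fin: "finite A" "finite B" and dis: "A \<inter> B = {}"
    and x: "x \<in> car (obj H A)" and y: "y \<in> car (obj H B)"
  shows "iterated_form H \<eta> \<gamma> (mu H A B (pure (obj H A) (obj H B) x y)) =
    iterated_form H \<eta> (restrict_comp \<gamma> A) x * iterated_form H \<eta> (restrict_comp \<gamma> B) y"
proof -
  have "iterated_form H \<eta> (restrict_comp \<gamma> X) z = iterated_form H \<eta> (map (\<lambda>S. S \<inter> X) \<gamma>) z"
    if "X \<subseteq> A \<union> B" "z \<in> car (obj H X)" for X z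
  proof -
    have "sorted_wrt disjnt (map (\<lambda>S. S \<inter> X) \<gamma>)"
      unfolding sorted_wrt_map
      by (rule sorted_wrt_mono_rel[OF _ set_compositionsD(2)[OF \<gamma>]]) (auto simp: disjnt_def)
    moreover have "\<Union>(set (map (\<lambda>S. S \<inter> X) \<gamma>)) = X"
      using set_compositionsD(3)[OF \<gamma>] that(1) by auto
    moreover have "finite X" using that(1) fin finite_subset by blast
    ultimately show ?thesis
      using iterated_form_filter[of "map (\<lambda>S. S \<inter> X) \<gamma>" z] that(2) unfolding restrict_comp_def by simp
  qed
  note restrict = this[of A x] this[of B y]
  show ?thesis
    using iterated_form_mu[OF set_compositionsD(2,3)[OF \<gamma>] fin dis x y] restrict x y by simp
qed

text \<open>On pure tensors the coefficients at \<open>\<gamma>\<close> of both sides are the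
  product of the iterated forms of the two restrictions of \<open>\<gamma>\<close>; uniqueness
  extends this to all tensors.\<close>

lemma upsilon_monoid_morphism: "monoid_morphism H WQSym (upsilon H \<eta>)"
  unfolding monoid_morphism_def obj_WQSym
proof (intro conjI allI impI ballI)
  show "species_morphism H WQSym (upsilon H \<eta>)" by (rule upsilon_species_morphism)
  show "upsilon H \<eta> {} (iota H c) = iota WQSym c" for c
  proof -
    have "iota H c \<in> car (obj H {})" using linear_mapD(1)[OF iota_linear, of c] by simp
    then show ?thesis
      by (auto simp: upsilon_eq set_compositions_empty eta_iota WQSym_def fscale_def mono_basis_def)
  qed
  fix A B t assume AB: "finite A \<and> finite B \<and> A \<inter> B = {}" and t: "t \<in> car (obj H A \<otimes> obj H B)"
  then have fin: "finite A" "finite B" and dis: "A \<inter> B = {}" and finAB: "finite (A \<union> B)" by auto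
  let ?T = "tensor_map (obj H A) (obj H B) (wqsym_obj A) (wqsym_obj B) (upsilon H \<eta> A) (upsilon H \<eta> B)"
  note ul = upsilon_linear[OF fin(1)] upsilon_linear[OF fin(2)]
  note T = tensor_map_linear[OF vec[OF fin(1)] vec[OF fin(2)] is_vec_wqsym is_vec_wqsym ul]
  note L = linear_map_comp[OF mu_linear[OF fin dis] upsilon_linear[OF finAB]]
    and R = linear_map_comp[OF T(1) mu_WQSym(1)[OF fin]]
  show "upsilon H \<eta> (A \<union> B) (mu H A B t) = mu WQSym A B (?T t)"
  proof (rule tensor_map_unique[OF is_vec_wqsym L R _ t])
    fix x y assume x: "x \<in> car (obj H A)" and y: "y \<in> car (obj H B)"
    have m: "mu H A B (pure (obj H A) (obj H B) x y) \<in> car (obj H (A \<union> B))"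
      by (rule linear_mapD(1)[OF mu_linear[OF fin dis] pure_in_tensor[OF x y]])
    show "upsilon H \<eta> (A \<union> B) (mu H A B (pure (obj H A) (obj H B) x y)) =
        mu WQSym A B (?T (pure (obj H A) (obj H B) x y))"
    proof
      fix \<gamma>
      have r: "\<gamma> \<in> set_compositions (A \<union> B) \<Longrightarrow> restrict_comp \<gamma> A \<in> set_compositions A"
        "\<gamma> \<in> set_compositions (A \<union> B) \<Longrightarrow> restrict_comp \<gamma> B \<in> set_compositions B"
        by (auto intro: restrict_set_composition)
      have "mu WQSym A B (?T (pure (obj H A) (obj H B) x y)) \<gamma> =
          (if \<gamma> \<in> set_compositions (A \<union> B)
            then upsilon H \<eta> A x (restrict_comp \<gamma> A) * upsilon H \<eta> B y (restrict_comp \<gamma> B) else 0)"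
        unfolding T(2)[OF x y]
        by (rule mu_WQSym(2)[OF fin linear_mapD(1)[OF ul(1) x] linear_mapD(1)[OF ul(2) y]])
      then show "upsilon H \<eta> (A \<union> B) (mu H A B (pure (obj H A) (obj H B) x y)) \<gamma> =
          mu WQSym A B (?T (pure (obj H A) (obj H B) x y)) \<gamma>"
        using m r x y fin by (simp add: upsilon_eq iterated_form_mu_restrict[OF _ fin dis x y])
    qed
  qed
qed

text \<open>\<open>eta0\<close> reads off the coefficient at \<open>[I]\<close>, or at the empty
  list if \<open>I\<close> is empty; in either case the corresponding iterated form agrees with
  \<open>\<eta> I\<close> on the carrier.\<close>

lemma upsilon_eta0:
  assumes "finite I" and "x \<in> car (obj H I)"
  shows "eta0 I (upsilon H \<eta> I x) = \<eta> I x"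
proof (cases "I = {}")
  case True
  then show ?thesis using assms by (simp add: eta0_empty upsilon_eq set_compositions_empty)
next
  case False
  then show ?thesis
    using assms iterated_form_singleton[OF assms] singleton_set_composition[OF False]
    \<comment> \<open>The recursion stays folded so that the lemma on singletons still
      matches.\<close>
    by (simp add: eta0_nonempty upsilon_eq del: iterated_form.simps)
qed

lemma comb_hopf_morphism_upsilon: "comb_hopf_morphism H \<eta> WQSym eta0 (upsilon H \<eta>)"
  unfolding comb_hopf_morphism_def hopf_morphism_def
  by (intro conjI allI impI ballI upsilon_monoid_morphism upsilon_comonoid_morphism upsilon_eta0)

section \<open>Uniqueness: the coefficients are forced\<close>

text \<open>Induction on the composition. The coproduct of WQSym splits off the first block, whose
  coefficient is prescribed by the character; the remaining coefficient is known by
  induction.\<close>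

lemma comb_hopf_morphism_coefficient:
  assumes \<alpha>: "comb_hopf_morphism H \<eta> WQSym eta0 \<alpha>"
    and "finite I" and "x \<in> car (obj H I)" and "\<pi> \<in> set_compositions I"
  shows "\<alpha> I x \<pi> = iterated_form H \<eta> \<pi> x"
  using assms(2-4)
proof (induction \<pi> arbitrary: I x)
  case Nil
  then have "I = {}" using set_compositionsD(3) by fastforce
  \<comment> \<open>The counit of WQSym is the coefficient at the empty composition, and for a
    character \<open>eps H\<close> coincides with \<open>\<eta> {}\<close>.\<close>
  have "eps WQSym (\<alpha> {} x) = eps H x"
    using \<alpha> Nil \<open>I = {}\<close> unfolding comb_hopf_morphism_def hopf_morphism_def comonoid_morphism_def
    by blast
  then show ?case using Nil \<open>I = {}\<close> by (simp add: eps_WQSym eta_eps)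
next
  case (Cons S \<rho>)
  let ?P = "\<Union>(set \<rho>)"
  note \<rho> = set_compositions_ConsD[OF Cons.prems(3)]
  have fin: "finite S" "finite ?P" using Cons.prems(1) \<rho>(2) by auto
  have x: "x \<in> car (obj H (S \<union> ?P))" using Cons.prems(2) \<rho>(2) by simp
  have co: "comonoid_morphism H WQSym \<alpha>"
    using \<alpha> unfolding comb_hopf_morphism_def hopf_morphism_def by blast
  \<comment> \<open>This is compatibility with the characters, as \<open>eta0\<close> on the
    non-empty block \<open>S\<close> is the coefficient at \<open>[S]\<close>.\<close>
  have S: "\<alpha> S y [S] = \<eta> S y" if "y \<in> car (obj H S)" for y
    using \<alpha> that fin(1) eta0_nonempty[OF fin(1) \<rho>(1), of "\<alpha> S y"]
    unfolding comb_hopf_morphism_def by simp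
  \<comment> \<open>The composition is read as the concatenation of \<open>[S]\<close> and
    \<open>\<rho>\<close>, which makes its coefficient a convolution that can be pulled back along
    \<open>\<alpha>\<close>.\<close>
  have "\<alpha> I x (S # \<rho>) = convolution WQSym S ?P (\<lambda>f. f [S]) (\<lambda>g. g \<rho>) (\<alpha> (S \<union> ?P) x)"
    unfolding \<rho>(2)
    by (subst convolution_WQSym[OF fin \<rho>(3) singleton_set_composition[OF \<rho>(1)] \<rho>(4)]) simp
  also have "\<dots> = convolution H S ?P (\<lambda>y. \<alpha> S y [S]) (\<lambda>z. \<alpha> ?P z \<rho>) x"
    by (rule comonoid_morphism_convolution[OF comonoid_species_axioms _ co fin \<rho>(3) _ _ x])
      (simp_all add: obj_WQSym is_vec_wqsym coefficient_linear)
  also have "\<dots> = convolution H S ?P (\<eta> S) (iterated_form H \<eta> \<rho>) x"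
    by (rule convolution_cong[OF fin \<rho>(3) eta_linear[OF fin(1)] composition_form_linear[OF fin(2) \<rho>(4)]
          _ _ x, symmetric]) (simp_all add: S Cons.IH[OF fin(2) _ \<rho>(4)])
  finally show ?case by simp
qed

text \<open>The coefficient formula settles finite sets, carrier elements and compositions.
  Extensionality covers infinite sets and vectors outside the carriers, and the support condition
  covers lists that are not compositions.\<close>

lemma comb_hopf_morphism_unique:
  assumes \<alpha>: "comb_hopf_morphism H \<eta> WQSym eta0 \<alpha>"
    and carrier: "\<alpha> \<in> (\<Pi>\<^sub>E I\<in>{I. finite I}. car (obj H I) \<rightarrow>\<^sub>E car (obj WQSym I))"
  shows "\<alpha> = upsilon H \<eta>"
proof (intro ext)
  fix I x \<pi>
  show "\<alpha> I x \<pi> = upsilon H \<eta> I x \<pi>"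
  proof (cases "finite I")
    case False
    then show ?thesis using PiE_arb[OF carrier, of I] by (simp add: upsilon_def)
  next
    case True
    then have e: "\<alpha> I \<in> car (obj H I) \<rightarrow>\<^sub>E car (wqsym_obj I)"
      using PiE_mem[OF carrier, of I] by (simp add: obj_WQSym)
    show ?thesis
    proof (cases "x \<in> car (obj H I)")
      case False
      then show ?thesis using PiE_arb[OF e False] True by (simp add: upsilon_def)
    next
      case x: True
      then have "\<alpha> I x \<in> car (wqsym_obj I)" by (rule PiE_mem[OF e])
      then show ?thesis
        using comb_hopf_morphism_coefficient[OF \<alpha> True x, of \<pi>] True x
        by (simp add: upsilon_eq wqsym_iff)
    qed
  qed
qed

end

theorem theorem49:
  fixes h :: "('a::infinite, 'k::field_char_0, 'v::ab_group_add) bimonoid_species"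
    and \<eta> :: "'a set \<Rightarrow> 'v \<Rightarrow> 'k"
  assumes "hopf_monoid h" and "character h \<eta>"
  shows "\<exists>!\<Upsilon>. \<Upsilon> \<in> (\<Pi>\<^sub>E I\<in>{I. finite I}. car (obj h I) \<rightarrow>\<^sub>E car (obj WQSym I)) \<and>
    comb_hopf_morphism h \<eta> WQSym eta0 \<Upsilon>"
proof -
  interpret hopf_monoid h by fact
  \<comment> \<open>A Hopf monoid is already a bimonoid, so only the character property remains to
    be supplied.\<close>
  interpret combinatorial_bimonoid h \<eta> by unfold_locales fact
  have "upsilon h \<eta> \<in> (\<Pi>\<^sub>E I\<in>{I. finite I}. car (obj h I) \<rightarrow>\<^sub>E car (obj WQSym I))"
    using linear_mapD(1)[OF upsilon_linear] by (auto simp: upsilon_def obj_WQSym)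
  then show ?thesis
  proof (intro ex1I conjI)
    show "comb_hopf_morphism h \<eta> WQSym eta0 (upsilon h \<eta>)"
      by (rule comb_hopf_morphism_upsilon)
  qed (auto intro: comb_hopf_morphism_unique)
qed

end
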